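(* Let $A=\bigoplus_{n\ge 0}A_n$ be a tower of algebras over $\mathbb{C}$. If the Grothendieck groups $G(A)$ and $K(A)$ of $A$ form a pair of graded dual Hopf algebras, then $\dim_{\mathbb{C}}(A_n)=r^n\,n!$ for all $n\ge 0$, where $r=\dim_{\mathbb{C}}(A_1)$.
   Context: A tower of algebras is a graded algebra $A=\bigoplus_{n\ge0}A_n$ over $\mathbb{C}$ with (external, associative) multiplication $\rho=(\rho_{m,n})$, $\rho_{m,n}\colon A_m\otimes A_n\to A_{m+n}$, such that: (1) each $A_n$ is itself a finite-dimensional associative algebra with its own internal multiplication and unit $1_n$, and $A_0\cong\mathbb{C}$; (2) each $\rho_{m,n}$ is an injective homomorphism of algebras (for the internal multiplications) sending $1_m\otimes 1_n$ to $1_{m+n}$; (3) $A_{m+n}$ is projective both as a left and as a right $A_m\otimes A_n$-module, where $A_m\otimes A_n$ acts through $\rho_{m,n}$ and internal multiplication in $A_{m+n}$. For a finite-dimensional algebra $B$, $G_0(B)$ is the Grothendieck group of finitely generated left $B$-modules (free abelian on classes of simple modules) and $K_0(B)$ is the Grothendieck group of finitely generated projective left $B$-modules (free abelian on classes of indecomposable projectives). Put $G(A)=\bigoplus_{n\ge0}G_0(A_n)$ and $K(A)=\bigoplus_{n\ge0}K_0(A_n)$. Both carry a multiplication and comultiplication given by $$[M][N]=\left[\mathrm{Ind}_{A_m\otimes A_n}^{A_{m+n}}M\otimes N\right]\ (M\text{ over }A_m,\ N\text{ over }A_n),\qquad \Delta([N])=\sum_{k+l=n}\left[\mathrm{Res}^{A_{n}}_{A_k\otimes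 A_l}N\right]\ (N\text{ over }A_n),$$ where induction is $A_{m+n}\otimes_{A_m\otimes A_n}-$ and restriction is along $\rho$, and where the class of an $A_k\otimes A_l$-module is viewed in $G_0(A_k)\otimes G_0(A_l)$ (resp. $K_0(A_k)\otimes K_0(A_l)$). The pairing $\langle\cdot,\cdot\rangle\colon K(A)\times G(A)\to\mathbb{Z}$ is $\langle [P],[M]\rangle=\dim_{\mathbb{C}}\mathrm{Hom}_{A_n}(P,M)$ if $P$ and $M$ are both modules over the same $A_n$, and $0$ if their degrees differ. "The Grothendieck groups form a pair of graded dual Hopf algebras" means that, with these operations, $G(A)$ and $K(A)$ are graded connected Hopf algebras over $\mathbb{Z}$ which are graded dual to each other under this pairing (the product of each is adjoint to the coproduct of the other). *)

theory Defs
  imports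
    "HOL-Algebra.Free_Abelian_Groups"
    "HOL-Algebra.IntRing"
    "HOL-Algebra.Elementary_Groups"
    "HOL-Algebra.Generated_Groups"
    "Jordan_Normal_Form.VS_Connect"
begin

hide_const (open) Polynomial.smult Multiset.mult Ring_Hom.ring_hom

section \<open>Modules over a not necessarily commutative ring\<close>

text \<open>Modules are records of type \<^typ>\<open>('r, 'm) module\<close>; the fields for an internal multiplication
  and its unit are ignored. A right module over \<open>R\<close> is a left module over \<open>opposite R\<close>, so that
  its scalar operation sends \<open>r, m\<close> to \<open>m r\<close>.\<close>

definition opposite :: "('a, 'e) ring_scheme \<Rightarrow> ('a, 'e) ring_scheme" where
  "opposite R = R\<lparr>mult := (\<lambda>x y. y \<otimes>\<^bsub>R\<^esub> x)\<rparr>"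

definition left_module :: "('r, 'e) ring_scheme \<Rightarrow> ('r, 'm) module \<Rightarrow> bool" where
  "left_module R M \<longleftrightarrow> ring R \<and> abelian_group M \<and>
     (\<forall>r\<in>carrier R. \<forall>x\<in>carrier M. r \<odot>\<^bsub>M\<^esub> x \<in> carrier M) \<and>
     (\<forall>r\<in>carrier R. \<forall>s\<in>carrier R. \<forall>x\<in>carrier M.
        (r \<oplus>\<^bsub>R\<^esub> s) \<odot>\<^bsub>M\<^esub> x = r \<odot>\<^bsub>M\<^esub> x \<oplus>\<^bsub>M\<^esub> s \<odot>\<^bsub>M\<^esub> x) \<and>
     (\<forall>r\<in>carrier R. \<forall>x\<in>carrier M. \<forall>y\<in>carrier M.
        r \<odot>\<^bsub>M\<^esub> (x \<oplus>\<^bsub>M\<^esub> y) = r \<odot>\<^bsub>M\<^esub> x \<oplus>\<^bsub>M\<^esub> r \<odot>\<^bsub>M\<^esub> y) \<and>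
     (\<forall>r\<in>carrier R. \<forall>s\<in>carrier R. \<forall>x\<in>carrier M.
        (r \<otimes>\<^bsub>R\<^esub> s) \<odot>\<^bsub>M\<^esub> x = r \<odot>\<^bsub>M\<^esub> (s \<odot>\<^bsub>M\<^esub> x)) \<and>
     (\<forall>x\<in>carrier M. \<one>\<^bsub>R\<^esub> \<odot>\<^bsub>M\<^esub> x = x)"

definition module_homs ::
  "('r, 'e) ring_scheme \<Rightarrow> ('r, 'm) module \<Rightarrow> ('r, 'n) module \<Rightarrow> ('m \<Rightarrow> 'n) set" where
  "module_homs R M N = {f \<in> carrier M \<rightarrow>\<^sub>E carrier N.
     (\<forall>x\<in>carrier M. \<forall>y\<in>carrier M. f (x \<oplus>\<^bsub>M\<^esub> y) = f x \<oplus>\<^bsub>N\<^esub> f y) \<and>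
     (\<forall>r\<in>carrier R. \<forall>x\<in>carrier M. f (r \<odot>\<^bsub>M\<^esub> x) = r \<odot>\<^bsub>N\<^esub> f x)}"

definition module_isomorphic ::
  "('r, 'e) ring_scheme \<Rightarrow> ('r, 'm) module \<Rightarrow> ('r, 'n) module \<Rightarrow> bool" where
  "module_isomorphic R M N \<longleftrightarrow> (\<exists>f\<in>module_homs R M N. bij_betw f (carrier M) (carrier N))"

definition short_exact ::
  "('r, 'e) ring_scheme \<Rightarrow> ('r, 'l) module \<Rightarrow> ('r, 'm) module \<Rightarrow> ('r, 'n) module \<Rightarrow> bool" where
  "short_exact R L M N \<longleftrightarrow> (\<exists>f\<in>module_homs R L M. \<exists>g\<in>module_homs R M N.
     inj_on f (carrier L) \<and> f ` carrier L = {x \<in> carrier M. g x = \<zero>\<^bsub>N\<^esub>} \<and>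
     g ` carrier M = carrier N)"

definition finitely_generated_module :: "('r, 'e) ring_scheme \<Rightarrow> ('r, 'm) module \<Rightarrow> bool" where
  "finitely_generated_module R M \<longleftrightarrow> (\<exists>S. finite S \<and> S \<subseteq> carrier M \<and>
     (\<forall>x\<in>carrier M. \<exists>c\<in>S \<rightarrow> carrier R. x = (\<Oplus>\<^bsub>M\<^esub>s\<in>S. c s \<odot>\<^bsub>M\<^esub> s)))"

definition free_module :: "('r, 'e) ring_scheme \<Rightarrow> 'i set \<Rightarrow> ('r, 'i \<Rightarrow> 'r) module" where
  "free_module R I = \<lparr>carrier = {f \<in> I \<rightarrow>\<^sub>E carrier R. finite {i \<in> I. f i \<noteq> \<zero>\<^bsub>R\<^esub>}},
     mult = undefined, one = undefined,
     zero = (\<lambda>i\<in>I. \<zero>\<^bsub>R\<^esub>), add = (\<lambda>f g. \<lambda>i\<in>I. f i \<oplus>\<^bsub>R\<^esub> g i),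
     smult = (\<lambda>r f. \<lambda>i\<in>I. r \<otimes>\<^bsub>R\<^esub> f i)\<rparr>"

text \<open>Projective means: direct summand of a free module. Index sets inside the type of elements
  of \<open>P\<close> suffice, because a projective \<open>P\<close> is a summand of the free module on its own carrier.\<close>

definition projective_module :: "('r, 'e) ring_scheme \<Rightarrow> ('r, 'p) module \<Rightarrow> bool" where
  "projective_module R P \<longleftrightarrow> left_module R P \<and>
     (\<exists>I :: 'p set. \<exists>s\<in>module_homs R P (free_module R I). \<exists>p\<in>module_homs R (free_module R I) P.
        \<forall>x\<in>carrier P. p (s x) = x)"

definition left_regular :: "('a, 'e) ring_scheme \<Rightarrow> ('a, 'a) module" where
  "left_regular B = \<lparr>carrier = carrier B, mult = undefined, one = undefined,
     zero = \<zero>\<^bsub>B\<^esub>, add = add B, smult = (\<lambda>b x. b \<otimes>\<^bsub>B\<^esub> x)\<rparr>"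

definition right_regular :: "('a, 'e) ring_scheme \<Rightarrow> ('a, 'a) module" where
  "right_regular B = left_regular (opposite B)"

definition restrict_scalars :: "('s \<Rightarrow> 'r) \<Rightarrow> ('r, 'm) module \<Rightarrow> ('s, 'm) module" where
  "restrict_scalars \<phi> M = \<lparr>carrier = carrier M, mult = mult M, one = one M,
     zero = zero M, add = add M, smult = (\<lambda>s x. \<phi> s \<odot>\<^bsub>M\<^esub> x)\<rparr>"

text \<open>The additively written module on a multiplicatively written commutative group.\<close>

definition module_on :: "'g monoid \<Rightarrow> ('r \<Rightarrow> 'g \<Rightarrow> 'g) \<Rightarrow> ('r, 'g) module" where
  "module_on G act = \<lparr>carrier = carrier G, mult = undefined, one = undefined,
     zero = \<one>\<^bsub>G\<^esub>, add = mult G, smult = act\<rparr>"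

definition int_module :: "'g monoid \<Rightarrow> (int, 'g) module" where
  "int_module G = module_on G (\<lambda>k x. x [^]\<^bsub>G\<^esub> k)"


section \<open>Tensor products\<close>

text \<open>\<open>tensor R M N\<close> is \<open>M \<otimes>\<^sub>R N\<close> for a right module \<open>M\<close> and a left module \<open>N\<close>, as
  an abelian group in the multiplicative notation of \<^const>\<open>free_Abelian_group\<close>; note that
  \<open>frag_of p\<close> is the generator \<open>p\<close> and that free abelian groups use \<open>+\<close> on \<open>\<Rightarrow>\<^sub>0\<close>.\<close>

type_synonym ('m, 'n) tensor = "('m \<times> 'n \<Rightarrow>\<^sub>0 int) set"

definition tensor_relations ::
  "('r, 'e) ring_scheme \<Rightarrow> ('r, 'm) module \<Rightarrow> ('r, 'n) module \<Rightarrow> ('m \<times> 'n \<Rightarrow>\<^sub>0 int) set" where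
  "tensor_relations R M N =
     {frag_of (x \<oplus>\<^bsub>M\<^esub> x', y) - frag_of (x, y) - frag_of (x', y) | x x' y.
        x \<in> carrier M \<and> x' \<in> carrier M \<and> y \<in> carrier N} \<union>
     {frag_of (x, y \<oplus>\<^bsub>N\<^esub> y') - frag_of (x, y) - frag_of (x, y') | x y y'.
        x \<in> carrier M \<and> y \<in> carrier N \<and> y' \<in> carrier N} \<union>
     {frag_of (r \<odot>\<^bsub>M\<^esub> x, y) - frag_of (x, r \<odot>\<^bsub>N\<^esub> y) | r x y.
        r \<in> carrier R \<and> x \<in> carrier M \<and> y \<in> carrier N}"

definition tensor_kernel ::
  "('r, 'e) ring_scheme \<Rightarrow> ('r, 'm) module \<Rightarrow> ('r, 'n) module \<Rightarrow> ('m \<times> 'n \<Rightarrow>\<^sub>0 int) set" where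
  "tensor_kernel R M N =
     generate (free_Abelian_group (carrier M \<times> carrier N)) (tensor_relations R M N)"

definition tensor ::
  "('r, 'e) ring_scheme \<Rightarrow> ('r, 'm) module \<Rightarrow> ('r, 'n) module \<Rightarrow> ('m, 'n) tensor monoid" where
  "tensor R M N = free_Abelian_group (carrier M \<times> carrier N) Mod tensor_kernel R M N"

definition pure_tensor ::
  "('r, 'e) ring_scheme \<Rightarrow> ('r, 'm) module \<Rightarrow> ('r, 'n) module \<Rightarrow> 'm \<Rightarrow> 'n \<Rightarrow> ('m, 'n) tensor" where
  "pure_tensor R M N x y =
     tensor_kernel R M N #>\<^bsub>free_Abelian_group (carrier M \<times> carrier N)\<^esub> frag_of (x, y)"

text \<open>The map from a tensor product to the commutative group \<open>K\<close> induced by a balanced biadditive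
  map \<open>\<beta>\<close>, that is, the homomorphism with \<open>x \<otimes> y \<mapsto> \<beta> x y\<close>: evaluate \<open>\<beta>\<close> on a representative.\<close>

definition tensor_lift :: "('k, 'e) monoid_scheme \<Rightarrow> ('m \<Rightarrow> 'n \<Rightarrow> 'k) \<Rightarrow> ('m, 'n) tensor \<Rightarrow> 'k" where
  "tensor_lift K \<beta> t = (THE z. \<exists>p\<in>t.
     z = (\<Otimes>\<^bsub>K\<^esub>q\<in>Poly_Mapping.keys p. \<beta> (fst q) (snd q) [^]\<^bsub>K\<^esub> Poly_Mapping.lookup p q))"

definition tensor_algebra ::
  "('r, 'e) ring_scheme \<Rightarrow> ('r, 'b) module \<Rightarrow> ('r, 'c) module \<Rightarrow> ('r, ('b, 'c) tensor) module" where
  "tensor_algebra R B C = (let T = tensor R B C; pt = pure_tensor R B C in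
     \<lparr>carrier = carrier T,
      mult = (\<lambda>s t. tensor_lift T (\<lambda>b c. tensor_lift T (\<lambda>b' c'.
                pt (b \<otimes>\<^bsub>B\<^esub> b') (c \<otimes>\<^bsub>C\<^esub> c')) t) s),
      one = pt \<one>\<^bsub>B\<^esub> \<one>\<^bsub>C\<^esub>, zero = \<one>\<^bsub>T\<^esub>, add = mult T,
      smult = (\<lambda>r. tensor_lift T (\<lambda>b c. pt (r \<odot>\<^bsub>B\<^esub> b) c))\<rparr>)"

text \<open>\<open>B \<otimes>\<^sub>R M\<close> for a ring homomorphism \<open>\<phi>\<close> from \<open>R\<close> to \<open>B\<close>, where \<open>R\<close> acts on \<open>B\<close> from the right
  through \<open>\<phi>\<close>.\<close>

definition induced_module ::
  "('r, 'e) ring_scheme \<Rightarrow> ('b, 'f) ring_scheme \<Rightarrow> ('r \<Rightarrow> 'b) \<Rightarrow> ('r, 'm) module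
     \<Rightarrow> ('b, ('b, 'm) tensor) module" where
  "induced_module R B \<phi> M =
     (let U = restrict_scalars \<phi> (right_regular B); T = tensor R U M in
      module_on T (\<lambda>b. tensor_lift T (\<lambda>x m. pure_tensor R U M (b \<otimes>\<^bsub>B\<^esub> x) m)))"


section \<open>Finite-dimensional algebras and towers\<close>

definition fd_algebra :: "(complex, 'a) module \<Rightarrow> bool" where
  "fd_algebra B \<longleftrightarrow> ring B \<and> vectorspace class_ring B \<and> vectorspace.fin_dim class_ring B \<and>
     (\<forall>z. \<forall>x\<in>carrier B. \<forall>y\<in>carrier B.
        (z \<odot>\<^bsub>B\<^esub> x) \<otimes>\<^bsub>B\<^esub> y = z \<odot>\<^bsub>B\<^esub> (x \<otimes>\<^bsub>B\<^esub> y) \<and>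
        x \<otimes>\<^bsub>B\<^esub> (z \<odot>\<^bsub>B\<^esub> y) = z \<odot>\<^bsub>B\<^esub> (x \<otimes>\<^bsub>B\<^esub> y))"

definition algebra_homs :: "(complex, 'a) module \<Rightarrow> (complex, 'b) module \<Rightarrow> ('a \<Rightarrow> 'b) set" where
  "algebra_homs B C =
     {f \<in> ring_hom B C. \<forall>z. \<forall>x\<in>carrier B. f (z \<odot>\<^bsub>B\<^esub> x) = z \<odot>\<^bsub>C\<^esub> f x}"

definition complex_algebra :: "(complex, complex) module" where
  "complex_algebra = \<lparr>carrier = UNIV, mult = (*), one = 1, zero = 0, add = (+), smult = (*)\<rparr>"

abbreviation algebra_tensor ::
  "(complex, 'b) module \<Rightarrow> (complex, 'c) module \<Rightarrow> (complex, ('b, 'c) tensor) module" where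
  "algebra_tensor \<equiv> tensor_algebra class_ring"

text \<open>The complex vector space underlying a module over a complex algebra.\<close>

definition underlying_space :: "(complex, 'b) module \<Rightarrow> ('b, 'm) module \<Rightarrow> (complex, 'm) module" where
  "underlying_space B M = restrict_scalars (\<lambda>z. z \<odot>\<^bsub>B\<^esub> \<one>\<^bsub>B\<^esub>) M"

text \<open>The module \<open>M \<otimes> N\<close> over \<open>B \<otimes> C\<close>.\<close>

definition external_tensor ::
  "(complex, 'b) module \<Rightarrow> (complex, 'c) module \<Rightarrow> ('b, 'm) module \<Rightarrow> ('c, 'n) module
     \<Rightarrow> (('b, 'c) tensor, ('m, 'n) tensor) module" where
  "external_tensor B C M N =
     (let V = underlying_space B M; W = underlying_space C N; T = tensor class_ring V W in
      module_on T (\<lambda>s t. tensor_lift T (\<lambda>b c. tensor_lift T (\<lambda>m n.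
        pure_tensor class_ring V W (b \<odot>\<^bsub>M\<^esub> m) (c \<odot>\<^bsub>N\<^esub> n)) t) s))"

text \<open>The vector space of module homomorphisms, with pointwise operations.\<close>

definition hom_space ::
  "(complex, 'b) module \<Rightarrow> ('b, 'm) module \<Rightarrow> ('b, 'n) module \<Rightarrow> (complex, 'm \<Rightarrow> 'n) module" where
  "hom_space B M N = \<lparr>carrier = module_homs B M N, mult = undefined, one = undefined,
     zero = (\<lambda>x\<in>carrier M. \<zero>\<^bsub>N\<^esub>), add = (\<lambda>f g. \<lambda>x\<in>carrier M. f x \<oplus>\<^bsub>N\<^esub> g x),
     smult = (\<lambda>z f. \<lambda>x\<in>carrier M. (z \<odot>\<^bsub>B\<^esub> \<one>\<^bsub>B\<^esub>) \<odot>\<^bsub>N\<^esub> f x)\<rparr>"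

text \<open>The external product of \<open>x\<close> in degree \<open>m\<close> and \<open>y\<close> in degree \<open>n\<close> is \<open>\<rho> m n (x \<otimes> y)\<close>. A unit for
  it is not required separately: the map \<open>x \<mapsto> \<rho> 0 n (1 \<otimes> x)\<close> is injective and, by associativity,
  idempotent, hence the identity (likewise on the other side).\<close>

definition tower_of_algebras ::
  "(nat \<Rightarrow> (complex, 'a) module) \<Rightarrow> (nat \<Rightarrow> nat \<Rightarrow> ('a, 'a) tensor \<Rightarrow> 'a) \<Rightarrow> bool" where
  "tower_of_algebras A \<rho> \<longleftrightarrow>
     (\<forall>l m n. \<forall>x\<in>carrier (A l). \<forall>y\<in>carrier (A m). \<forall>z\<in>carrier (A n).
        \<rho> (l + m) n (pure_tensor class_ring (A (l + m)) (A n)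
           (\<rho> l m (pure_tensor class_ring (A l) (A m) x y)) z) =
        \<rho> l (m + n) (pure_tensor class_ring (A l) (A (m + n))
           x (\<rho> m n (pure_tensor class_ring (A m) (A n) y z)))) \<and>
     (\<forall>n. fd_algebra (A n)) \<and>
     (\<exists>f\<in>algebra_homs (A 0) complex_algebra. bij_betw f (carrier (A 0)) UNIV) \<and>
     (\<forall>m n. \<rho> m n \<in> algebra_homs (algebra_tensor (A m) (A n)) (A (m + n)) \<and>
        inj_on (\<rho> m n) (carrier (algebra_tensor (A m) (A n)))) \<and>
     (\<forall>m n. projective_module (algebra_tensor (A m) (A n))
          (restrict_scalars (\<rho> m n) (left_regular (A (m + n)))) \<and>
        projective_module (opposite (algebra_tensor (A m) (A n)))
          (restrict_scalars (\<rho> m n) (right_regular (A (m + n)))))"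


section \<open>Grothendieck groups\<close>

datatype module_class = All | Projective

text \<open>Every finitely generated module over a finite-dimensional complex algebra is isomorphic to one
  whose elements have type \<open>nat \<Rightarrow> complex\<close>, so these modules form a small category equivalent to
  that of all finitely generated modules.\<close>

definition modules_in ::
  "module_class \<Rightarrow> (complex, 'b) module \<Rightarrow> ('b, nat \<Rightarrow> complex) module set" where
  "modules_in \<kappa> B = {M. left_module B M \<and> finitely_generated_module B M \<and>
     (\<kappa> = Projective \<longrightarrow> projective_module B M)}"

type_synonym 'b gelement = "(('b, nat \<Rightarrow> complex) module \<Rightarrow>\<^sub>0 int) set"

definition grothendieck_kernel ::
  "module_class \<Rightarrow> (complex, 'b) module \<Rightarrow> 'b gelement" where
  "grothendieck_kernel \<kappa> B = generate (free_Abelian_group (modules_in \<kappa> B))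
     {frag_of M - frag_of L - frag_of N | L M N. L \<in> modules_in \<kappa> B \<and> M \<in> modules_in \<kappa> B \<and>
        N \<in> modules_in \<kappa> B \<and> short_exact B L M N}"

text \<open>\<open>grothendieck All B\<close> is $G_0(B)$ and \<open>grothendieck Projective B\<close> is $K_0(B)$.\<close>

definition grothendieck ::
  "module_class \<Rightarrow> (complex, 'b) module \<Rightarrow> 'b gelement monoid" where
  "grothendieck \<kappa> B = free_Abelian_group (modules_in \<kappa> B) Mod grothendieck_kernel \<kappa> B"

text \<open>The class of a module with elements of an arbitrary type; the choice of an isomorphic copy does
  not matter, since isomorphic modules have the same class.\<close>

definition mclass ::
  "module_class \<Rightarrow> (complex, 'b) module \<Rightarrow> ('b, 'm) module \<Rightarrow> 'b gelement" where
  "mclass \<kappa> B M = grothendieck_kernel \<kappa> B #>\<^bsub>free_Abelian_group (modules_in \<kappa> B)\<^esub>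
     frag_of (SOME M'. M' \<in> modules_in \<kappa> B \<and> module_isomorphic B M M')"

abbreviation grothendieck_tensor ::
  "module_class \<Rightarrow> (complex, 'b) module \<Rightarrow> (complex, 'c) module
     \<Rightarrow> ('b gelement, 'c gelement) tensor monoid" where
  "grothendieck_tensor \<kappa> B C \<equiv>
     tensor \<Z> (int_module (grothendieck \<kappa> B)) (int_module (grothendieck \<kappa> C))"

text \<open>The element \<open>t\<close> of $G_0(B) \otimes G_0(C)$ (or $K_0$) is \<open>X\<close>, an element of
  $G_0(B \otimes C)$, under the canonical isomorphism $[M] \otimes [N] \mapsto [M \otimes N]$.\<close>

definition identified ::
  "module_class \<Rightarrow> (complex, 'b) module \<Rightarrow> (complex, 'c) module
     \<Rightarrow> ('b gelement, 'c gelement) tensor \<Rightarrow> ('b, 'c) tensor gelement \<Rightarrow> bool" where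
  "identified \<kappa> B C t X \<longleftrightarrow> t \<in> carrier (grothendieck_tensor \<kappa> B C) \<and>
     (\<exists>\<phi>\<in>iso (grothendieck_tensor \<kappa> B C) (grothendieck \<kappa> (algebra_tensor B C)).
        (\<forall>M\<in>modules_in \<kappa> B. \<forall>N\<in>modules_in \<kappa> C.
           \<phi> (pure_tensor \<Z> (int_module (grothendieck \<kappa> B)) (int_module (grothendieck \<kappa> C))
                (mclass \<kappa> B M) (mclass \<kappa> C N)) =
           mclass \<kappa> (algebra_tensor B C) (external_tensor B C M N)) \<and>
        \<phi> t = X)"

definition grothendieck_sum ::
  "module_class \<Rightarrow> (nat \<Rightarrow> (complex, 'a) module) \<Rightarrow> (nat \<Rightarrow> 'a gelement) monoid" where
  "grothendieck_sum \<kappa> A = sum_group UNIV (\<lambda>n. grothendieck \<kappa> (A n))"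

definition in_degree ::
  "module_class \<Rightarrow> (nat \<Rightarrow> (complex, 'a) module) \<Rightarrow> nat \<Rightarrow> 'a gelement \<Rightarrow> nat \<Rightarrow> 'a gelement" where
  "in_degree \<kappa> A n x = (\<lambda>i. if i = n then x else \<one>\<^bsub>grothendieck \<kappa> (A i)\<^esub>)"

definition degree_part ::
  "module_class \<Rightarrow> (nat \<Rightarrow> (complex, 'a) module) \<Rightarrow> nat \<Rightarrow> (nat \<Rightarrow> 'a gelement) set" where
  "degree_part \<kappa> A n = in_degree \<kappa> A n ` carrier (grothendieck \<kappa> (A n))"


section \<open>Graded connected Hopf algebras over the integers\<close>

record 'h hopf = "'h ring" +
  comult :: "'h \<Rightarrow> ('h, 'h) tensor"
  counit :: "'h \<Rightarrow> int"
  antipode :: "'h \<Rightarrow> 'h"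

definition int_algebra :: "'h hopf \<Rightarrow> (int, 'h) module" where
  "int_algebra H = \<lparr>carrier = carrier H, mult = mult H, one = one H, zero = zero H, add = add H,
     smult = (\<lambda>k x. [k] \<cdot>\<^bsub>H\<^esub> x)\<rparr>"

definition tensor_square :: "'h hopf \<Rightarrow> (int, ('h, 'h) tensor) module" where
  "tensor_square H = tensor_algebra \<Z> (int_algebra H) (int_algebra H)"

definition hopf_pure :: "'h hopf \<Rightarrow> 'h \<Rightarrow> 'h \<Rightarrow> ('h, 'h) tensor" where
  "hopf_pure H = pure_tensor \<Z> (int_algebra H) (int_algebra H)"

text \<open>Both sides live in $H \otimes (H \otimes H)$: the left one is
  $(\mathrm{id} \otimes \Delta)\Delta(h)$, the right one is $(\Delta \otimes \mathrm{id})\Delta(h)$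
  rebracketed.\<close>

definition coassociative :: "'h hopf \<Rightarrow> bool" where
  "coassociative H \<longleftrightarrow>
     (let T = tensor \<Z> (int_algebra H) (tensor_square H);
          pt = pure_tensor \<Z> (int_algebra H) (tensor_square H) in
      \<forall>h\<in>carrier H.
        tensor_lift T (\<lambda>x y. pt x (comult H y)) (comult H h) =
        tensor_lift T (\<lambda>x y. tensor_lift T (\<lambda>u v. pt u (hopf_pure H v y)) (comult H x)) (comult H h))"

definition hopf_algebra :: "'h hopf \<Rightarrow> bool" where
  "hopf_algebra H \<longleftrightarrow> ring H \<and>
     comult H \<in> ring_hom H (tensor_square H) \<and> counit H \<in> ring_hom H \<Z> \<and>
     coassociative H \<and>
     (\<forall>h\<in>carrier H.
        tensor_lift (add_monoid H) (\<lambda>x y. [counit H x] \<cdot>\<^bsub>H\<^esub> y) (comult H h) = h \<and>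
        tensor_lift (add_monoid H) (\<lambda>x y. [counit H y] \<cdot>\<^bsub>H\<^esub> x) (comult H h) = h) \<and>
     antipode H \<in> hom (add_monoid H) (add_monoid H) \<and>
     (\<forall>h\<in>carrier H.
        tensor_lift (add_monoid H) (\<lambda>x y. antipode H x \<otimes>\<^bsub>H\<^esub> y) (comult H h) =
          [counit H h] \<cdot>\<^bsub>H\<^esub> \<one>\<^bsub>H\<^esub> \<and>
        tensor_lift (add_monoid H) (\<lambda>x y. x \<otimes>\<^bsub>H\<^esub> antipode H y) (comult H h) =
          [counit H h] \<cdot>\<^bsub>H\<^esub> \<one>\<^bsub>H\<^esub>)"

definition graded_hopf_algebra :: "'h hopf \<Rightarrow> (nat \<Rightarrow> 'h set) \<Rightarrow> bool" where
  "graded_hopf_algebra H D \<longleftrightarrow> hopf_algebra H \<and>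
     (\<forall>n. additive_subgroup (D n) H) \<and>
     (\<forall>h\<in>carrier H. \<exists>!c. (\<forall>n. c n \<in> D n) \<and> finite {n. c n \<noteq> \<zero>\<^bsub>H\<^esub>} \<and>
        h = (\<Oplus>\<^bsub>H\<^esub>n\<in>{n. c n \<noteq> \<zero>\<^bsub>H\<^esub>}. c n)) \<and>
     \<one>\<^bsub>H\<^esub> \<in> D 0 \<and>
     (\<forall>m n. \<forall>x\<in>D m. \<forall>y\<in>D n. x \<otimes>\<^bsub>H\<^esub> y \<in> D (m + n)) \<and>
     (\<forall>n. \<forall>x\<in>D n. comult H x \<in> generate (add_monoid (tensor_square H))
        {hopf_pure H y z | k l y z. k + l = n \<and> y \<in> D k \<and> z \<in> D l}) \<and>
     (\<forall>n>0. \<forall>x\<in>D n. counit H x = 0) \<and>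
     (\<forall>n. \<forall>x\<in>D n. antipode H x \<in> D n)"

definition connected_hopf_algebra :: "'h hopf \<Rightarrow> (nat \<Rightarrow> 'h set) \<Rightarrow> bool" where
  "connected_hopf_algebra H D \<longleftrightarrow> bij_betw (\<lambda>k. [k] \<cdot>\<^bsub>H\<^esub> \<one>\<^bsub>H\<^esub>) (UNIV :: int set) (D 0)"

text \<open>\<open>\<beta>\<close> exhibits \<open>H\<close> and \<open>H'\<close> as graded duals of each other: \<open>D n\<close> is identified with the
  dual of \<open>D' n\<close> and conversely, different degrees are orthogonal, and products are adjoint to
  coproducts, where $\langle x \otimes y, x' \otimes y'\rangle = \langle x, x'\rangle\langle y, y'\rangle$.\<close>

definition graded_dual ::
  "'h hopf \<Rightarrow> (nat \<Rightarrow> 'h set) \<Rightarrow> 'k hopf \<Rightarrow> (nat \<Rightarrow> 'k set) \<Rightarrow> ('h \<Rightarrow> 'k \<Rightarrow> int) \<Rightarrow> bool" where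
  "graded_dual H D H' D' \<beta> \<longleftrightarrow>
     (\<forall>m n. m \<noteq> n \<longrightarrow> (\<forall>x\<in>D m. \<forall>x'\<in>D' n. \<beta> x x' = 0)) \<and>
     (\<forall>n. bij_betw (\<lambda>x. \<lambda>x'\<in>D' n. \<beta> x x') (D n)
        {f \<in> extensional (D' n). \<forall>x'\<in>D' n. \<forall>y'\<in>D' n. f (x' \<oplus>\<^bsub>H'\<^esub> y') = f x' + f y'}) \<and>
     (\<forall>n. bij_betw (\<lambda>x'. \<lambda>x\<in>D n. \<beta> x x') (D' n)
        {f \<in> extensional (D n). \<forall>x\<in>D n. \<forall>y\<in>D n. f (x \<oplus>\<^bsub>H\<^esub> y) = f x + f y}) \<and>
     (\<forall>x\<in>carrier H. \<forall>y\<in>carrier H. \<forall>h\<in>carrier H'.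
        \<beta> (x \<otimes>\<^bsub>H\<^esub> y) h = tensor_lift integer_group (\<lambda>x' y'. \<beta> x x' * \<beta> y y') (comult H' h)) \<and>
     (\<forall>h\<in>carrier H. \<forall>x'\<in>carrier H'. \<forall>y'\<in>carrier H'.
        \<beta> h (x' \<otimes>\<^bsub>H'\<^esub> y') = tensor_lift integer_group (\<lambda>x y. \<beta> x x' * \<beta> y y') (comult H h))"


section \<open>The Grothendieck groups of a tower\<close>

text \<open>The additive group of \<open>H\<close> is $G(A)$ (for \<open>\<kappa> = All\<close>) or $K(A)$ (for \<open>\<kappa> = Projective\<close>), its product
  is given by induction and its coproduct by restriction. Since product and coproduct of a Hopf algebra
  are additive, these formulas determine them.\<close>

definition induction_product ::
  "module_class \<Rightarrow> (nat \<Rightarrow> (complex, 'a) module) \<Rightarrow> (nat \<Rightarrow> nat \<Rightarrow> ('a, 'a) tensor \<Rightarrow> 'a)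
     \<Rightarrow> (nat \<Rightarrow> 'a gelement) hopf \<Rightarrow> bool" where
  "induction_product \<kappa> A \<rho> H \<longleftrightarrow>
     (\<forall>m n. \<forall>M\<in>modules_in \<kappa> (A m). \<forall>N\<in>modules_in \<kappa> (A n).
        in_degree \<kappa> A m (mclass \<kappa> (A m) M) \<otimes>\<^bsub>H\<^esub> in_degree \<kappa> A n (mclass \<kappa> (A n) N) =
        in_degree \<kappa> A (m + n) (mclass \<kappa> (A (m + n))
          (induced_module (algebra_tensor (A m) (A n)) (A (m + n)) (\<rho> m n)
             (external_tensor (A m) (A n) M N))))"

definition restriction_coproduct ::
  "module_class \<Rightarrow> (nat \<Rightarrow> (complex, 'a) module) \<Rightarrow> (nat \<Rightarrow> nat \<Rightarrow> ('a, 'a) tensor \<Rightarrow> 'a)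
     \<Rightarrow> (nat \<Rightarrow> 'a gelement) hopf \<Rightarrow> bool" where
  "restriction_coproduct \<kappa> A \<rho> H \<longleftrightarrow>
     (\<forall>n. \<forall>N\<in>modules_in \<kappa> (A n). \<exists>t.
        (\<forall>k\<le>n. identified \<kappa> (A k) (A (n - k)) (t k)
           (mclass \<kappa> (algebra_tensor (A k) (A (n - k))) (restrict_scalars (\<rho> k (n - k)) N))) \<and>
        comult H (in_degree \<kappa> A n (mclass \<kappa> (A n) N)) =
          (\<Oplus>\<^bsub>tensor_square H\<^esub>k\<in>{..n}. tensor_lift (add_monoid (tensor_square H))
             (\<lambda>x y. hopf_pure H (in_degree \<kappa> A k x) (in_degree \<kappa> A (n - k) y)) (t k)))"

definition grothendieck_hopf ::
  "module_class \<Rightarrow> (nat \<Rightarrow> (complex, 'a) module) \<Rightarrow> (nat \<Rightarrow> nat \<Rightarrow> ('a, 'a) tensor \<Rightarrow> 'a)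
     \<Rightarrow> (nat \<Rightarrow> 'a gelement) hopf \<Rightarrow> bool" where
  "grothendieck_hopf \<kappa> A \<rho> H \<longleftrightarrow>
     carrier H = carrier (grothendieck_sum \<kappa> A) \<and> add H = mult (grothendieck_sum \<kappa> A) \<and>
     \<zero>\<^bsub>H\<^esub> = \<one>\<^bsub>grothendieck_sum \<kappa> A\<^esub> \<and>
     induction_product \<kappa> A \<rho> H \<and> restriction_coproduct \<kappa> A \<rho> H \<and>
     graded_hopf_algebra H (degree_part \<kappa> A) \<and> connected_hopf_algebra H (degree_part \<kappa> A)"

text \<open>The first conjunct is biadditivity; together with the values on classes it determines \<open>\<beta>\<close>.\<close>

definition hom_pairing ::
  "(nat \<Rightarrow> (complex, 'a) module)
     \<Rightarrow> ((nat \<Rightarrow> 'a gelement) \<Rightarrow> (nat \<Rightarrow> 'a gelement) \<Rightarrow> int) \<Rightarrow> bool" where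
  "hom_pairing A \<beta> \<longleftrightarrow>
     ((\<forall>x\<in>carrier (grothendieck_sum Projective A). \<beta> x \<in> hom (grothendieck_sum All A) integer_group) \<and>
      (\<forall>y\<in>carrier (grothendieck_sum All A).
         (\<lambda>x. \<beta> x y) \<in> hom (grothendieck_sum Projective A) integer_group)) \<and>
     (\<forall>m n. \<forall>P\<in>modules_in Projective (A m). \<forall>M\<in>modules_in All (A n).
        \<beta> (in_degree Projective A m (mclass Projective (A m) P))
          (in_degree All A n (mclass All (A n) M)) =
        (if m = n then int (vectorspace.dim class_ring (hom_space (A n) P M)) else 0))"

definition form_graded_dual_hopf_algebras ::
  "(nat \<Rightarrow> (complex, 'a) module) \<Rightarrow> (nat \<Rightarrow> nat \<Rightarrow> ('a, 'a) tensor \<Rightarrow> 'a) \<Rightarrow> bool" where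
  "form_graded_dual_hopf_algebras A \<rho> \<longleftrightarrow>
     (\<exists>K G \<beta>. grothendieck_hopf Projective A \<rho> K \<and> grothendieck_hopf All A \<rho> G \<and>
        hom_pairing A \<beta> \<and> graded_dual K (degree_part Projective A) G (degree_part All A) \<beta>)"

end

(* Inducing the regular module of A_m (x) A_n gives the regular module of A_(m+n). Hence the classes
   P_n = [A_n] in K(A) and G_n = [A_n] in G(A) satisfy P_1 P_n = P_(n+1) and G_1 G_n = G_(n+1), while
   <P_n, G_n> = dim End(A_n) = dim A_n. Multiplication by P_1 is adjoint to the operator
   x |-> sum <P_1, x_(1)> x_(2) on G(A). As G(A) is connected, the element G_1 of degree one is
   primitive, so this operator is a derivation with respect to products with G_1 and maps G_(n+1) to
   (n+1) <P_1, G_1> G_n. Therefore dim A_(n+1) = (n+1) r dim A_n. *)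

theory Submission
  imports Defs
begin

section \<open>The universal property of tensor products\<close>

text \<open>Regular modules carry the argument because they are projective, so that one and the same
  module has a class on either side of the pairing, and because an endomorphism of A_n is determined
  by the image of 1. The derivation property comes from the grading: <P_1, -> vanishes outside
  degree 1, so on a product a x with a of degree 1 it sees only the component of x in degree 0, and
  its value is <P_1, a> times the counit of x. The constant r is read off from the recursion at n =
  0, since dim A_0 = 1. Two encodings shape the details. Tensor products are quotients of free
  Abelian groups, so an identity between tensors is proved by comparing two homomorphisms on pure
  tensors. Classes are represented by modules with elements in
  \<open>nat \<Rightarrow> complex\<close>, so A_n is replaced by a copy with transported
  operations, and the isomorphism for the induced module has to undo this copying in both tensor
  factors.\<close>

lemma (in comm_group) hom_free_Abelian_group_eval:
  assumes h: "h \<in> hom (free_Abelian_group S) G" and p: "Poly_Mapping.keys p \<subseteq> S"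
  shows "h p = (\<Otimes>q\<in>Poly_Mapping.keys p. h (frag_of q) [^] Poly_Mapping.lookup p q)"
proof -
  interpret F: comm_group "free_Abelian_group S" by (rule abelian_free_Abelian_group)
  interpret h: group_hom "free_Abelian_group S" G h
    using h by unfold_locales
  have cmul: "h (frag_cmul k (frag_of q)) = h (frag_of q) [^] k" if "q \<in> S" for q k
  proof -
    have q: "frag_of q \<in> carrier (free_Abelian_group S)" using that by simp
    have "frag_cmul k (frag_of q) = frag_of q [^]\<^bsub>free_Abelian_group S\<^esub> k"
      using that by (subst int_pow_free_Abelian_group) auto
    then show ?thesis using h.hom_int_pow[OF q] by simp
  qed
  have sum: "finite X \<Longrightarrow> X \<subseteq> S \<Longrightarrow>
      h (\<Sum>q\<in>X. frag_cmul (c q) (frag_of q)) = (\<Otimes>q\<in>X. h (frag_of q) [^] c q)" for X c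
  proof (induction X rule: finite_induct)
    case empty
    then show ?case using h.hom_one by simp
  next
    case (insert a X)
    have a: "h (frag_of q) \<in> carrier G" if "q \<in> S" for q
      using that by (intro h.hom_closed) simp
    have c: "(\<Sum>q\<in>X. frag_cmul (c q) (frag_of q)) \<in> carrier (free_Abelian_group S)"
      using insert by (intro sum_closed_free_Abelian_group)
        (auto simp: keys_cmul intro!: order_trans[OF keys_cmul])
    have c': "frag_cmul (c a) (frag_of a) \<in> carrier (free_Abelian_group S)"
      using insert by (auto intro!: order_trans[OF keys_cmul])
    have "h (\<Sum>q\<in>insert a X. frag_cmul (c q) (frag_of q)) =
        h (frag_cmul (c a) (frag_of a)) \<otimes> h (\<Sum>q\<in>X. frag_cmul (c q) (frag_of q))"
      using h.hom_mult[OF c' c] insert by simp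
    also have "\<dots> = (\<Otimes>q\<in>insert a X. h (frag_of q) [^] c q)"
      using insert a cmul by (subst finprod_insert) auto
    finally show ?case .
  qed
  have "p = (\<Sum>q\<in>Poly_Mapping.keys p. frag_cmul (Poly_Mapping.lookup p q) (frag_of q))"
    using frag_expansion[of p] by (simp add: frag_extend_def)
  then have "h p = h (\<Sum>q\<in>Poly_Mapping.keys p. frag_cmul (Poly_Mapping.lookup p q) (frag_of q))"
    by (rule arg_cong)
  also have "\<dots> = (\<Otimes>q\<in>Poly_Mapping.keys p. h (frag_of q) [^] Poly_Mapping.lookup p q)"
    using p by (intro sum) auto
  finally show ?thesis .
qed

text \<open>Closure under the operations is what places the relations inside the free Abelian group
  on pairs. At this generality the locale applies to factors such as \<open>external_tensor\<close>,
  of which only closure has been established.\<close>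

locale tensor_factors =
  fixes R :: "('r, 'e) ring_scheme" and M :: "('r, 'm) module" and N :: "('r, 'n) module"
  assumes add_left_closed: "\<lbrakk>x \<in> carrier M; x' \<in> carrier M\<rbrakk> \<Longrightarrow> x \<oplus>\<^bsub>M\<^esub> x' \<in> carrier M"
    and add_right_closed: "\<lbrakk>y \<in> carrier N; y' \<in> carrier N\<rbrakk> \<Longrightarrow> y \<oplus>\<^bsub>N\<^esub> y' \<in> carrier N"
    and smult_left_closed: "\<lbrakk>r \<in> carrier R; x \<in> carrier M\<rbrakk> \<Longrightarrow> r \<odot>\<^bsub>M\<^esub> x \<in> carrier M"
    and smult_right_closed: "\<lbrakk>r \<in> carrier R; y \<in> carrier N\<rbrakk> \<Longrightarrow> r \<odot>\<^bsub>N\<^esub> y \<in> carrier N"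
begin

abbreviation "F \<equiv> free_Abelian_group (carrier M \<times> carrier N)"
abbreviation "T \<equiv> tensor R M N"
abbreviation "pt \<equiv> pure_tensor R M N"

lemma tensor_relations_subset: "tensor_relations R M N \<subseteq> carrier F"
proof -
  have diff: "p - p' \<in> carrier F" if "p \<in> carrier F" "p' \<in> carrier F" for p p'
    using that keys_diff[of p p'] by auto
  have keys: "frag_of a - frag_of b - frag_of c \<in> carrier F" 
    if "a \<in> carrier M \<times> carrier N" "b \<in> carrier M \<times> carrier N" "c \<in> carrier M \<times> carrier N" for a b c
    using that by (intro diff) auto
  have keys': "frag_of a - frag_of b \<in> carrier F" 
    if "a \<in> carrier M \<times> carrier N" "b \<in> carrier M \<times> carrier N" for a b
    using that by (intro diff) auto
  show ?thesis
    unfolding tensor_relations_def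
    using add_left_closed add_right_closed smult_left_closed smult_right_closed
    by (auto intro!: keys keys' simp del: carrier_free_Abelian_group_iff)
qed

lemma tensor_kernel_normal: "tensor_kernel R M N \<lhd> F"
  unfolding tensor_kernel_def
  by (intro comm_group.subgroup_imp_normal abelian_free_Abelian_group
      group.generate_is_subgroup tensor_relations_subset) simp

lemma tensor_comm_group: "comm_group T"
  unfolding tensor_def
  by (intro comm_group.abelian_FactGroup abelian_free_Abelian_group
      normal_imp_subgroup tensor_kernel_normal)

lemma quotient_map_hom: "(\<lambda>p. tensor_kernel R M N #>\<^bsub>F\<^esub> p) \<in> hom F T"
  unfolding tensor_def by (rule normal.r_coset_hom_Mod[OF tensor_kernel_normal])

lemma quotient_map_relation:
  assumes "p \<in> tensor_relations R M N"
  shows "tensor_kernel R M N #>\<^bsub>F\<^esub> p = \<one>\<^bsub>T\<^esub>"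
proof -
  have "p \<in> tensor_kernel R M N"
    unfolding tensor_kernel_def using assms by (rule generate.incl)
  then have "tensor_kernel R M N #>\<^bsub>F\<^esub> p = tensor_kernel R M N"
    by (metis group.coset_join2 group_free_Abelian_group normal_imp_subgroup subgroup.mem_carrier
        tensor_kernel_normal)
  then show ?thesis by (simp add: tensor_def FactGroup_def)
qed

lemma pure_tensor_closed [simp]:
  "\<lbrakk>x \<in> carrier M; y \<in> carrier N\<rbrakk> \<Longrightarrow> pt x y \<in> carrier T"
  unfolding pure_tensor_def by (rule hom_in_carrier[OF quotient_map_hom]) simp

lemma
  shows pure_tensor_add_left: "\<lbrakk>x \<in> carrier M; x' \<in> carrier M; y \<in> carrier N\<rbrakk> \<Longrightarrow>
      pt (x \<oplus>\<^bsub>M\<^esub> x') y = pt x y \<otimes>\<^bsub>T\<^esub> pt x' y"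
    and pure_tensor_add_right: "\<lbrakk>x \<in> carrier M; y \<in> carrier N; y' \<in> carrier N\<rbrakk> \<Longrightarrow>
      pt x (y \<oplus>\<^bsub>N\<^esub> y') = pt x y \<otimes>\<^bsub>T\<^esub> pt x y'"
    and pure_tensor_balanced: "\<lbrakk>r \<in> carrier R; x \<in> carrier M; y \<in> carrier N\<rbrakk> \<Longrightarrow>
      pt (r \<odot>\<^bsub>M\<^esub> x) y = pt x (r \<odot>\<^bsub>N\<^esub> y)"
proof -
  interpret T: comm_group T by (rule tensor_comm_group)
  interpret q: group_hom F T "\<lambda>p. tensor_kernel R M N #>\<^bsub>F\<^esub> p"
    by (intro group_hom.intro group_hom_axioms.intro quotient_map_hom T.is_group) simp
  have q_diff: "tensor_kernel R M N #>\<^bsub>F\<^esub> (p - p') =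
      (tensor_kernel R M N #>\<^bsub>F\<^esub> p) \<otimes>\<^bsub>T\<^esub> inv\<^bsub>T\<^esub> (tensor_kernel R M N #>\<^bsub>F\<^esub> p')"
    if "p \<in> carrier F" "p' \<in> carrier F" for p p'
    using q.hom_mult[OF that(1) q.G.inv_closed[OF that(2)]] q.hom_inv[OF that(2)] that by simp
  \<comment> \<open>In the quotient the relation a - b - c becomes trivial, which in multiplicative
    notation says that a is the product of b and c.\<close>
  have three: "tensor_kernel R M N #>\<^bsub>F\<^esub> frag_of a = (tensor_kernel R M N #>\<^bsub>F\<^esub> frag_of b) \<otimes>\<^bsub>T\<^esub>
       (tensor_kernel R M N #>\<^bsub>F\<^esub> frag_of c)"
    if "frag_of a - frag_of b - frag_of c \<in> tensor_relations R M N"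
      "a \<in> carrier M \<times> carrier N" "b \<in> carrier M \<times> carrier N" "c \<in> carrier M \<times> carrier N" for a b c
  proof -
    have abc: "frag_of a \<in> carrier F" "frag_of b \<in> carrier F" "frag_of c \<in> carrier F"
      using that by auto
    then have ab: "frag_of a - frag_of b \<in> carrier F"
      using that by (auto intro!: order_trans[OF keys_diff] Un_least simp del: mem_Times_iff)
    show ?thesis
      using quotient_map_relation[OF that(1)] abc[THEN q.hom_closed]
      unfolding q_diff[OF ab abc(3)] q_diff[OF abc(1,2)]
      by (metis T.inv_closed T.inv_solve_right T.l_one T.m_closed T.m_comm T.one_closed)
  qed
  have two: "tensor_kernel R M N #>\<^bsub>F\<^esub> frag_of a = tensor_kernel R M N #>\<^bsub>F\<^esub> frag_of b"
    if "frag_of a - frag_of b \<in> tensor_relations R M N"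
      "a \<in> carrier M \<times> carrier N" "b \<in> carrier M \<times> carrier N" for a b
  proof -
    have ab: "frag_of a \<in> carrier F" "frag_of b \<in> carrier F"
      using that by auto
    show ?thesis
      using quotient_map_relation[OF that(1)] ab[THEN q.hom_closed]
      unfolding q_diff[OF ab]
      by (metis T.inv_closed T.inv_solve_right T.l_one T.m_closed T.m_comm T.one_closed)
  qed
  show "pt (x \<oplus>\<^bsub>M\<^esub> x') y = pt x y \<otimes>\<^bsub>T\<^esub> pt x' y"
    if "x \<in> carrier M" "x' \<in> carrier M" "y \<in> carrier N"
    unfolding pure_tensor_def using that
    by (intro three) (auto simp: tensor_relations_def add_left_closed)
  show "pt x (y \<oplus>\<^bsub>N\<^esub> y') = pt x y \<otimes>\<^bsub>T\<^esub> pt x y'"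
    if "x \<in> carrier M" "y \<in> carrier N" "y' \<in> carrier N"
    unfolding pure_tensor_def using that
    by (intro three) (auto simp: tensor_relations_def add_right_closed)
  show "pt (r \<odot>\<^bsub>M\<^esub> x) y = pt x (r \<odot>\<^bsub>N\<^esub> y)"
    if "r \<in> carrier R" "x \<in> carrier M" "y \<in> carrier N"
    unfolding pure_tensor_def using that
    by (intro two) (auto simp: tensor_relations_def smult_left_closed smult_right_closed)
qed

text \<open>Division as the inductive step mirrors \<open>free_Abelian_group_induct\<close>:
  repeated differences of generators reach every integer combination, so negative coefficients have
  no case of their own.\<close>

lemma tensor_induct [consumes 1, case_names one pure div]:
  assumes t: "t \<in> carrier T"
    and one: "P \<one>\<^bsub>T\<^esub>"
    and pure: "\<And>x y. \<lbrakk>x \<in> carrier M; y \<in> carrier N\<rbrakk> \<Longrightarrow> P (pt x y)"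
    and div: "\<And>s t. \<lbrakk>s \<in> carrier T; t \<in> carrier T; P s; P t\<rbrakk> \<Longrightarrow> P (s \<otimes>\<^bsub>T\<^esub> inv\<^bsub>T\<^esub> t)"
  shows "P t"
proof -
  interpret T: comm_group T by (rule tensor_comm_group)
  interpret q: group_hom F T "\<lambda>p. tensor_kernel R M N #>\<^bsub>F\<^esub> p"
    by (intro group_hom.intro group_hom_axioms.intro quotient_map_hom T.is_group) simp
  obtain p where p: "p \<in> carrier F" "t = tensor_kernel R M N #>\<^bsub>F\<^esub> p"
    using t unfolding tensor_def carrier_FactGroup by auto
  have "P (tensor_kernel R M N #>\<^bsub>F\<^esub> p)"
  proof (rule free_Abelian_group_induct[of p "carrier M \<times> carrier N"])
    show "Poly_Mapping.keys p \<subseteq> carrier M \<times> carrier N" using p by simp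
    show "P (tensor_kernel R M N #>\<^bsub>F\<^esub> 0)" using one q.hom_one by simp
    show "P (tensor_kernel R M N #>\<^bsub>F\<^esub> (x - y))"
      if "Poly_Mapping.keys x \<subseteq> carrier M \<times> carrier N" "Poly_Mapping.keys y \<subseteq> carrier M \<times> carrier N"
        "P (tensor_kernel R M N #>\<^bsub>F\<^esub> x)" "P (tensor_kernel R M N #>\<^bsub>F\<^esub> y)" for x y
    proof -
      have xy: "x \<in> carrier F" "y \<in> carrier F" using that by auto
      have "tensor_kernel R M N #>\<^bsub>F\<^esub> (x - y) =
          (tensor_kernel R M N #>\<^bsub>F\<^esub> x) \<otimes>\<^bsub>T\<^esub> inv\<^bsub>T\<^esub> (tensor_kernel R M N #>\<^bsub>F\<^esub> y)"
        using q.hom_mult[OF xy(1) q.G.inv_closed[OF xy(2)]] q.hom_inv[OF xy(2)] xy by simp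
      then show ?thesis using div that(3,4) xy[THEN q.hom_closed] by simp
    qed
    show "P (tensor_kernel R M N #>\<^bsub>F\<^esub> frag_of a)" if "a \<in> carrier M \<times> carrier N" for a
      using pure[of "fst a" "snd a"] that unfolding pure_tensor_def by auto
  qed
  then show ?thesis using p by simp
qed

text \<open>Pure tensors generate the tensor product. This is the uniqueness half of the universal
  property; most identities between tensors below present both sides as homomorphisms in one
  variable and compare them on pure tensors.\<close>

lemma tensor_hom_eqI:
  assumes K: "group K" and h: "h \<in> hom T K" and h': "h' \<in> hom T K"
    and eq: "\<And>x y. \<lbrakk>x \<in> carrier M; y \<in> carrier N\<rbrakk> \<Longrightarrow> h (pt x y) = h' (pt x y)"
    and t: "t \<in> carrier T"
  shows "h t = h' t"
proof -
  interpret T: comm_group T by (rule tensor_comm_group)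
  interpret h: group_hom T K h
    by (intro group_hom.intro group_hom_axioms.intro assms T.is_group)
  interpret h': group_hom T K h'
    by (intro group_hom.intro group_hom_axioms.intro assms T.is_group)
  show ?thesis using t by (induction rule: tensor_induct) (simp_all add: eq)
qed

end

section \<open>Existence in the universal property: lifts of balanced maps\<close>

locale balanced_map = tensor_factors R M N + K?: comm_group K
  for R :: "('r, 'e) ring_scheme" and M :: "('r, 'm) module" and N :: "('r, 'n) module"
    and K :: "('k, 'f) monoid_scheme" +
  fixes \<beta> :: "'m \<Rightarrow> 'n \<Rightarrow> 'k"
  assumes map_closed: "\<lbrakk>x \<in> carrier M; y \<in> carrier N\<rbrakk> \<Longrightarrow> \<beta> x y \<in> carrier K"
    and map_add_left: "\<lbrakk>x \<in> carrier M; x' \<in> carrier M; y \<in> carrier N\<rbrakk> \<Longrightarrow>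
      \<beta> (x \<oplus>\<^bsub>M\<^esub> x') y = \<beta> x y \<otimes>\<^bsub>K\<^esub> \<beta> x' y"
    and map_add_right: "\<lbrakk>x \<in> carrier M; y \<in> carrier N; y' \<in> carrier N\<rbrakk> \<Longrightarrow>
      \<beta> x (y \<oplus>\<^bsub>N\<^esub> y') = \<beta> x y \<otimes>\<^bsub>K\<^esub> \<beta> x y'"
    and map_balanced: "\<lbrakk>r \<in> carrier R; x \<in> carrier M; y \<in> carrier N\<rbrakk> \<Longrightarrow>
      \<beta> (r \<odot>\<^bsub>M\<^esub> x) y = \<beta> x (r \<odot>\<^bsub>N\<^esub> y)"
begin

text \<open>\<open>tensor_lift\<close> is a definite description over the representatives of a
  coset, so its formula must be shown to be independent of the representative. The formula computes
  the homomorphism h of the free Abelian group that extends \<beta>; by the axioms of a balanced map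
  h kills all relations, hence \<open>tensor_kernel\<close>, hence is constant on cosets.\<close>

lemma tensor_lift_aux:
  obtains h where "h \<in> hom F K"
    "\<And>x y. \<lbrakk>x \<in> carrier M; y \<in> carrier N\<rbrakk> \<Longrightarrow> h (frag_of (x, y)) = \<beta> x y"
    "\<And>p. p \<in> carrier F \<Longrightarrow> tensor_lift K \<beta> (tensor_kernel R M N #>\<^bsub>F\<^esub> p) = h p"
proof -
  obtain h where h: "h \<in> hom F K"
    and h_frag: "\<And>q. q \<in> carrier M \<times> carrier N \<Longrightarrow> h (frag_of q) = \<beta> (fst q) (snd q)"
    by (rule K.free_Abelian_group_universal[of "\<lambda>q. \<beta> (fst q) (snd q)" "carrier M \<times> carrier N"])
      (auto simp: map_closed)
  interpret h: group_hom F K h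
    by (intro group_hom.intro group_hom_axioms.intro h K.is_group) simp
  have h_diff: "h (p - p') = h p \<otimes>\<^bsub>K\<^esub> inv\<^bsub>K\<^esub> h p'" if "p \<in> carrier F" "p' \<in> carrier F" for p p'
    using h.hom_mult[OF that(1) h.G.inv_closed[OF that(2)]] h.hom_inv[OF that(2)] that by simp
  have three: "h (frag_of a - frag_of b - frag_of c) = \<one>\<^bsub>K\<^esub>"
    if "h (frag_of a) = h (frag_of b) \<otimes>\<^bsub>K\<^esub> h (frag_of c)"
      "a \<in> carrier M \<times> carrier N" "b \<in> carrier M \<times> carrier N" "c \<in> carrier M \<times> carrier N" for a b c
  proof -
    have abc: "frag_of a \<in> carrier F" "frag_of b \<in> carrier F" "frag_of c \<in> carrier F"
      using that by auto
    then have ab: "frag_of a - frag_of b \<in> carrier F"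
      using that by (auto intro!: order_trans[OF keys_diff] Un_least simp del: mem_Times_iff)
    show ?thesis
      unfolding h_diff[OF ab abc(3)] h_diff[OF abc(1,2)] that(1)
      using abc[THEN h.hom_closed]
      by (metis K.inv_closed K.m_assoc K.m_comm K.m_closed K.r_inv K.r_one)
  qed
  have two: "h (frag_of a - frag_of b) = \<one>\<^bsub>K\<^esub>"
    if "h (frag_of a) = h (frag_of b)" "a \<in> carrier M \<times> carrier N" "b \<in> carrier M \<times> carrier N" for a b
  proof -
    have ab: "frag_of a \<in> carrier F" "frag_of b \<in> carrier F"
      using that by auto
    show ?thesis unfolding h_diff[OF ab] that(1) using ab[THEN h.hom_closed] by simp
  qed
  have rel: "h p = \<one>\<^bsub>K\<^esub>" if "p \<in> tensor_relations R M N" for p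
    using that unfolding tensor_relations_def
    by (auto intro!: three two simp: h_frag map_add_left map_add_right map_balanced
        add_left_closed add_right_closed smult_left_closed smult_right_closed)
  have kernel: "h p = \<one>\<^bsub>K\<^esub>" if "p \<in> tensor_kernel R M N" for p
  proof -
    have "tensor_kernel R M N \<subseteq> kernel F K h"
      unfolding tensor_kernel_def
    proof (intro h.G.generate_subgroup_incl h.subgroup_kernel subsetI)
      fix p assume "p \<in> tensor_relations R M N"
      then show "p \<in> kernel F K h"
        using rel tensor_relations_subset unfolding kernel_def by blast
    qed
    then show ?thesis using that by (auto simp: kernel_def)
  qed
  \<comment> \<open>This is the expression inside the definition of \<open>tensor_lift\<close>; it
    arises by writing p as the combination of its keys.\<close>
  have eval: "h p = (\<Otimes>\<^bsub>K\<^esub>q\<in>Poly_Mapping.keys p. \<beta> (fst q) (snd q) [^]\<^bsub>K\<^esub> Poly_Mapping.lookup p q)"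
    if "p \<in> carrier F" for p
  proof -
    have "h p = (\<Otimes>\<^bsub>K\<^esub>q\<in>Poly_Mapping.keys p. h (frag_of q) [^]\<^bsub>K\<^esub> Poly_Mapping.lookup p q)"
      using that by (intro hom_free_Abelian_group_eval[OF h]) simp
    also have "\<dots> = (\<Otimes>\<^bsub>K\<^esub>q\<in>Poly_Mapping.keys p. \<beta> (fst q) (snd q) [^]\<^bsub>K\<^esub> Poly_Mapping.lookup p q)"
      using that
      by (intro K.finprod_cong) (auto simp: h_frag map_closed Pi_iff simp_implies_def subset_iff)
    finally show ?thesis .
  qed
  have lift: "tensor_lift K \<beta> (tensor_kernel R M N #>\<^bsub>F\<^esub> p) = h p" if p: "p \<in> carrier F" for p
    unfolding tensor_lift_def
  proof (rule the_equality)
    have "p \<in> tensor_kernel R M N #>\<^bsub>F\<^esub> p"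
      using p tensor_kernel_normal by (simp add: group.rcos_self normal_imp_subgroup)
    then show "\<exists>p'\<in>tensor_kernel R M N #>\<^bsub>F\<^esub> p. h p =
        (\<Otimes>\<^bsub>K\<^esub>q\<in>Poly_Mapping.keys p'. \<beta> (fst q) (snd q) [^]\<^bsub>K\<^esub> Poly_Mapping.lookup p' q)"
      by (rule bexI[rotated]) (rule eval[OF p])
  next
    fix z
    assume "\<exists>p\<in>tensor_kernel R M N #>\<^bsub>F\<^esub> p. z =
        (\<Otimes>\<^bsub>K\<^esub>q\<in>Poly_Mapping.keys p. \<beta> (fst q) (snd q) [^]\<^bsub>K\<^esub> Poly_Mapping.lookup p q)"
    then obtain k where k: "k \<in> tensor_kernel R M N" "z = (\<Otimes>\<^bsub>K\<^esub>q\<in>Poly_Mapping.keys (k \<otimes>\<^bsub>F\<^esub> p).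
        \<beta> (fst q) (snd q) [^]\<^bsub>K\<^esub> Poly_Mapping.lookup (k \<otimes>\<^bsub>F\<^esub> p) q)"
      unfolding r_coset_def by blast
    have kF: "k \<in> carrier F"
      using subgroup.mem_carrier[OF normal_imp_subgroup[OF tensor_kernel_normal] k(1)] .
    have "z = h (k \<otimes>\<^bsub>F\<^esub> p)"
      unfolding k(2) by (rule eval[OF h.G.m_closed[OF kF p], symmetric])
    also have "\<dots> = h p"
      unfolding h.hom_mult[OF kF p] kernel[OF k(1)] by (rule K.l_one[OF h.hom_closed[OF p]])
    finally show "z = h p" .
  qed
  show thesis
    by (rule that[OF h _ lift]) (simp add: h_frag)
qed

lemma tensor_lift_hom: "tensor_lift K \<beta> \<in> hom T K"
proof -
  obtain h where h: "h \<in> hom F K"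
    "\<And>p. p \<in> carrier F \<Longrightarrow> tensor_lift K \<beta> (tensor_kernel R M N #>\<^bsub>F\<^esub> p) = h p"
    by (rule tensor_lift_aux) (rule that, assumption+)
  interpret h: group_hom F K h
    by (intro group_hom.intro group_hom_axioms.intro h K.is_group) simp
  interpret T: comm_group T by (rule tensor_comm_group)
  interpret q: group_hom F T "\<lambda>p. tensor_kernel R M N #>\<^bsub>F\<^esub> p"
    by (intro group_hom.intro group_hom_axioms.intro quotient_map_hom T.is_group) simp
  have rep: "\<exists>p\<in>carrier F. t = tensor_kernel R M N #>\<^bsub>F\<^esub> p" if "t \<in> carrier T" for t
    using that unfolding tensor_def carrier_FactGroup by auto
  show ?thesis
  proof (rule homI)
    show "tensor_lift K \<beta> t \<in> carrier K" if "t \<in> carrier T" for t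
      using rep[OF that] h by auto
    show "tensor_lift K \<beta> (s \<otimes>\<^bsub>T\<^esub> t) = tensor_lift K \<beta> s \<otimes>\<^bsub>K\<^esub> tensor_lift K \<beta> t"
      if st: "s \<in> carrier T" "t \<in> carrier T" for s t
    proof -
      obtain p p' where p: "p \<in> carrier F" "s = tensor_kernel R M N #>\<^bsub>F\<^esub> p"
        "p' \<in> carrier F" "t = tensor_kernel R M N #>\<^bsub>F\<^esub> p'" using rep st by blast
      then have "s \<otimes>\<^bsub>T\<^esub> t = tensor_kernel R M N #>\<^bsub>F\<^esub> (p \<otimes>\<^bsub>F\<^esub> p')"
        using q.hom_mult[OF p(1,3)] by (simp only:)
      then have "tensor_lift K \<beta> (s \<otimes>\<^bsub>T\<^esub> t) = h (p \<otimes>\<^bsub>F\<^esub> p')"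
        using h(2)[OF h.G.m_closed[OF p(1,3)]] by (simp only:)
      also have "\<dots> = h p \<otimes>\<^bsub>K\<^esub> h p'" using p(1,3) by (rule h.hom_mult)
      finally show ?thesis unfolding p(2,4) h(2)[OF p(1)] h(2)[OF p(3)] .
    qed
  qed
qed

lemma tensor_lift_pure:
  assumes "x \<in> carrier M" "y \<in> carrier N"
  shows "tensor_lift K \<beta> (pt x y) = \<beta> x y"
proof -
  obtain h where h:
    "\<And>x y. \<lbrakk>x \<in> carrier M; y \<in> carrier N\<rbrakk> \<Longrightarrow> h (frag_of (x, y)) = \<beta> x y"
    "\<And>p. p \<in> carrier F \<Longrightarrow> tensor_lift K \<beta> (tensor_kernel R M N #>\<^bsub>F\<^esub> p) = h p"
    by (rule tensor_lift_aux) (rule that, assumption+)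
  have "frag_of (x, y) \<in> carrier F" using assms by simp
  then show ?thesis unfolding pure_tensor_def by (simp only: h(2) h(1)[OF assms])
qed

end

lemma (in tensor_factors) id_hom_tensor: "(\<lambda>t. t) \<in> hom T T"
  by (rule homI) (use tensor_comm_group in \<open>auto simp: comm_group_def comm_monoid_def monoid.m_closed\<close>)

lemma (in comm_group) hom_mult_pointwise:
  assumes "h \<in> hom H G" "h' \<in> hom H G"
  shows "(\<lambda>x. h x \<otimes> h' x) \<in> hom H G"
  by (rule homI) (use assms in \<open>auto simp: hom_mult hom_in_carrier m_ac\<close>)

text \<open>A nested lift has parameters in its inner map. Both sides are homomorphisms in t, so
  additivity in a parameter can be tested on pure tensors; \<open>balanced_map_lift_cong\<close>
  serves in the same way for moving a scalar between two parameters.\<close>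

lemma balanced_map_lift_mult:
  assumes "balanced_map R M N K \<beta>" "balanced_map R M N K \<beta>'" "balanced_map R M N K \<beta>''"
    and eq: "\<And>x y. \<lbrakk>x \<in> carrier M; y \<in> carrier N\<rbrakk> \<Longrightarrow> \<beta> x y = \<beta>' x y \<otimes>\<^bsub>K\<^esub> \<beta>'' x y"
    and t: "t \<in> carrier (tensor R M N)"
  shows "tensor_lift K \<beta> t = tensor_lift K \<beta>' t \<otimes>\<^bsub>K\<^esub> tensor_lift K \<beta>'' t"
proof -
  interpret 1: balanced_map R M N K \<beta> by (rule assms)
  interpret 2: balanced_map R M N K \<beta>' by (rule assms)
  interpret 3: balanced_map R M N K \<beta>'' by (rule assms)
  show ?thesis
    by (rule "1.tensor_hom_eqI"[where h = "tensor_lift K \<beta>"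
          and h' = "\<lambda>t. tensor_lift K \<beta>' t \<otimes>\<^bsub>K\<^esub> tensor_lift K \<beta>'' t",
          OF "1.K.is_group" "1.tensor_lift_hom"
            "1.K.hom_mult_pointwise"[OF "2.tensor_lift_hom" "3.tensor_lift_hom"]])
      (simp_all add: t eq "1.tensor_lift_pure" "2.tensor_lift_pure" "3.tensor_lift_pure")
qed

lemma balanced_map_lift_cong:
  assumes "balanced_map R M N K \<beta>" "balanced_map R M N K \<beta>'"
    and eq: "\<And>x y. \<lbrakk>x \<in> carrier M; y \<in> carrier N\<rbrakk> \<Longrightarrow> \<beta> x y = \<beta>' x y"
    and t: "t \<in> carrier (tensor R M N)"
  shows "tensor_lift K \<beta> t = tensor_lift K \<beta>' t"
proof -
  interpret 1: balanced_map R M N K \<beta> by (rule assms)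
  interpret 2: balanced_map R M N K \<beta>' by (rule assms)
  show ?thesis
    by (rule "1.tensor_hom_eqI"[where h = "tensor_lift K \<beta>" and h' = "tensor_lift K \<beta>'",
          OF "1.K.is_group" "1.tensor_lift_hom" "2.tensor_lift_hom"])
      (simp_all add: t eq "1.tensor_lift_pure" "2.tensor_lift_pure")
qed

section \<open>Tensor products of algebras acting on tensor products of modules\<close>

text \<open>\<open>act\<close> makes \<open>B \<otimes> C\<close> act on \<open>V \<otimes> W\<close> when \<open>B\<close> acts on \<open>V\<close> and \<open>C\<close> acts on \<open>W\<close>. It covers both the
  multiplication of \<^const>\<open>tensor_algebra\<close> and the scalar operation of \<^const>\<open>external_tensor\<close>.\<close>

locale tensor_action = S: tensor_factors R B C + V: tensor_factors R V W
  for R :: "('r, 'e) ring_scheme" and B :: "('r, 'b) module" and C :: "('r, 'c) module"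
    and V :: "('r, 'v) module" and W :: "('r, 'w) module" +
  fixes f :: "'b \<Rightarrow> 'v \<Rightarrow> 'v" and g :: "'c \<Rightarrow> 'w \<Rightarrow> 'w"
  assumes f_closed: "\<lbrakk>b \<in> carrier B; v \<in> carrier V\<rbrakk> \<Longrightarrow> f b v \<in> carrier V"
    and f_add_left: "\<lbrakk>b \<in> carrier B; b' \<in> carrier B; v \<in> carrier V\<rbrakk> \<Longrightarrow>
      f (b \<oplus>\<^bsub>B\<^esub> b') v = f b v \<oplus>\<^bsub>V\<^esub> f b' v"
    and f_add_right: "\<lbrakk>b \<in> carrier B; v \<in> carrier V; v' \<in> carrier V\<rbrakk> \<Longrightarrow>
      f b (v \<oplus>\<^bsub>V\<^esub> v') = f b v \<oplus>\<^bsub>V\<^esub> f b v'"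
    and f_smult_left: "\<lbrakk>r \<in> carrier R; b \<in> carrier B; v \<in> carrier V\<rbrakk> \<Longrightarrow>
      f (r \<odot>\<^bsub>B\<^esub> b) v = r \<odot>\<^bsub>V\<^esub> f b v"
    and f_smult_right: "\<lbrakk>r \<in> carrier R; b \<in> carrier B; v \<in> carrier V\<rbrakk> \<Longrightarrow>
      f b (r \<odot>\<^bsub>V\<^esub> v) = r \<odot>\<^bsub>V\<^esub> f b v"
    and g_closed: "\<lbrakk>c \<in> carrier C; w \<in> carrier W\<rbrakk> \<Longrightarrow> g c w \<in> carrier W"
    and g_add_left: "\<lbrakk>c \<in> carrier C; c' \<in> carrier C; w \<in> carrier W\<rbrakk> \<Longrightarrow>
      g (c \<oplus>\<^bsub>C\<^esub> c') w = g c w \<oplus>\<^bsub>W\<^esub> g c' w"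
    and g_add_right: "\<lbrakk>c \<in> carrier C; w \<in> carrier W; w' \<in> carrier W\<rbrakk> \<Longrightarrow>
      g c (w \<oplus>\<^bsub>W\<^esub> w') = g c w \<oplus>\<^bsub>W\<^esub> g c w'"
    and g_smult_left: "\<lbrakk>r \<in> carrier R; c \<in> carrier C; w \<in> carrier W\<rbrakk> \<Longrightarrow>
      g (r \<odot>\<^bsub>C\<^esub> c) w = r \<odot>\<^bsub>W\<^esub> g c w"
    and g_smult_right: "\<lbrakk>r \<in> carrier R; c \<in> carrier C; w \<in> carrier W\<rbrakk> \<Longrightarrow>
      g c (r \<odot>\<^bsub>W\<^esub> w) = r \<odot>\<^bsub>W\<^esub> g c w"
begin

definition act :: "('b, 'c) tensor \<Rightarrow> ('v, 'w) tensor \<Rightarrow> ('v, 'w) tensor" where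
  "act s t = tensor_lift V.T (\<lambda>b c. tensor_lift V.T (\<lambda>v w. V.pt (f b v) (g c w)) t) s"

lemma balanced_inner:
  assumes "b \<in> carrier B" "c \<in> carrier C"
  shows "balanced_map R V W V.T (\<lambda>v w. V.pt (f b v) (g c w))"
proof -
  interpret VT: comm_group V.T by (rule V.tensor_comm_group)
  show ?thesis
    by unfold_locales
      (simp_all add: assms f_closed g_closed f_add_right g_add_right f_smult_right g_smult_right
        V.pure_tensor_add_left V.pure_tensor_add_right V.pure_tensor_balanced)
qed

text \<open>The map of b and c that is to be lifted is itself a lift evaluated at t. Its additivity
  and balancedness are tested by comparing inner lifts on pure tensors, where they follow from the
  linearity of f and g in their first argument.\<close>

lemma balanced_outer:
  assumes t: "t \<in> carrier V.T"
  shows "balanced_map R B C V.T (\<lambda>b c. tensor_lift V.T (\<lambda>v w. V.pt (f b v) (g c w)) t)"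
proof -
  interpret VT: comm_group V.T by (rule V.tensor_comm_group)
  note hom = balanced_map.tensor_lift_hom[OF balanced_inner]
  show ?thesis
  proof unfold_locales
    fix b c assume bc: "b \<in> carrier B" "c \<in> carrier C"
    show "tensor_lift V.T (\<lambda>v w. V.pt (f b v) (g c w)) t \<in> carrier V.T"
      using hom_in_carrier[OF hom[OF bc] t] .
  next
    fix b b' c assume bc: "b \<in> carrier B" "b' \<in> carrier B" "c \<in> carrier C"
    show "tensor_lift V.T (\<lambda>v w. V.pt (f (b \<oplus>\<^bsub>B\<^esub> b') v) (g c w)) t =
        tensor_lift V.T (\<lambda>v w. V.pt (f b v) (g c w)) t \<otimes>\<^bsub>V.T\<^esub>
        tensor_lift V.T (\<lambda>v w. V.pt (f b' v) (g c w)) t"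
      using t bc
      by (intro balanced_map_lift_mult[OF balanced_inner balanced_inner balanced_inner])
        (simp_all add: S.add_left_closed f_add_left f_closed g_closed V.pure_tensor_add_left)
  next
    fix b c c' assume bc: "b \<in> carrier B" "c \<in> carrier C" "c' \<in> carrier C"
    show "tensor_lift V.T (\<lambda>v w. V.pt (f b v) (g (c \<oplus>\<^bsub>C\<^esub> c') w)) t =
        tensor_lift V.T (\<lambda>v w. V.pt (f b v) (g c w)) t \<otimes>\<^bsub>V.T\<^esub>
        tensor_lift V.T (\<lambda>v w. V.pt (f b v) (g c' w)) t"
      using t bc
      by (intro balanced_map_lift_mult[OF balanced_inner balanced_inner balanced_inner])
        (simp_all add: S.add_right_closed g_add_left f_closed g_closed V.pure_tensor_add_right)
  next
    fix r b c assume bc: "r \<in> carrier R" "b \<in> carrier B" "c \<in> carrier C"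
    show "tensor_lift V.T (\<lambda>v w. V.pt (f (r \<odot>\<^bsub>B\<^esub> b) v) (g c w)) t =
        tensor_lift V.T (\<lambda>v w. V.pt (f b v) (g (r \<odot>\<^bsub>C\<^esub> c) w)) t"
      using t bc
      by (intro balanced_map_lift_cong[OF balanced_inner balanced_inner])
        (simp_all add: S.smult_left_closed S.smult_right_closed f_smult_left g_smult_left
          f_closed g_closed V.pure_tensor_balanced)
  qed
qed

lemma act_hom_left: "t \<in> carrier V.T \<Longrightarrow> (\<lambda>s. act s t) \<in> hom S.T V.T"
  unfolding act_def by (rule balanced_map.tensor_lift_hom[OF balanced_outer])

lemma act_closed: "\<lbrakk>s \<in> carrier S.T; t \<in> carrier V.T\<rbrakk> \<Longrightarrow> act s t \<in> carrier V.T"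
  using hom_in_carrier[OF act_hom_left] .

lemma act_pure_left: "\<lbrakk>b \<in> carrier B; c \<in> carrier C; t \<in> carrier V.T\<rbrakk> \<Longrightarrow>
    act (S.pt b c) t = tensor_lift V.T (\<lambda>v w. V.pt (f b v) (g c w)) t"
  unfolding act_def by (rule balanced_map.tensor_lift_pure[OF balanced_outer])

lemma act_pure: "\<lbrakk>b \<in> carrier B; c \<in> carrier C; v \<in> carrier V; w \<in> carrier W\<rbrakk> \<Longrightarrow>
    act (S.pt b c) (V.pt v w) = V.pt (f b v) (g c w)"
  by (simp add: act_pure_left balanced_map.tensor_lift_pure[OF balanced_inner])

text \<open>\<open>act\<close> is a lift in s, so the other argument is reached indirectly: for pure
  s the action is an inner lift, hence additive in t, and both sides are homomorphisms in s.\<close>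

lemma act_mult_right:
  assumes s: "s \<in> carrier S.T" and t: "t \<in> carrier V.T" "t' \<in> carrier V.T"
  shows "act s (t \<otimes>\<^bsub>V.T\<^esub> t') = act s t \<otimes>\<^bsub>V.T\<^esub> act s t'"
proof -
  interpret VT: comm_group V.T by (rule V.tensor_comm_group)
  show ?thesis
    by (rule S.tensor_hom_eqI[where h = "\<lambda>s. act s (t \<otimes>\<^bsub>V.T\<^esub> t')"
          and h' = "\<lambda>s. act s t \<otimes>\<^bsub>V.T\<^esub> act s t'", OF VT.is_group act_hom_left
            VT.hom_mult_pointwise[OF act_hom_left act_hom_left]])
      (simp_all add: s t act_pure_left hom_mult[OF balanced_map.tensor_lift_hom[OF balanced_inner]])
qed

lemma act_hom_right: "s \<in> carrier S.T \<Longrightarrow> act s \<in> hom V.T V.T"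
  by (rule homI) (simp_all add: act_closed act_mult_right)

end

section \<open>Induced modules\<close>

text \<open>The hypotheses say that \<open>\<theta>\<close> behaves like an isomorphism of \<open>E\<close> with the regular module of \<open>S\<close>,
  as far as \<open>\<phi>\<close> can see.\<close>

lemma induced_regular_module_isomorphic:
  fixes S :: "('s, 'e) ring_scheme" and B :: "('b, 'f) ring_scheme" and E :: "('s, 'm) module"
  assumes B: "ring B"
    and \<phi>: "\<And>s. s \<in> carrier S \<Longrightarrow> \<phi> s \<in> carrier B"
    and E_add: "\<And>e e'. \<lbrakk>e \<in> carrier E; e' \<in> carrier E\<rbrakk> \<Longrightarrow> e \<oplus>\<^bsub>E\<^esub> e' \<in> carrier E"
    and E_smult: "\<And>s e. \<lbrakk>s \<in> carrier S; e \<in> carrier E\<rbrakk> \<Longrightarrow> s \<odot>\<^bsub>E\<^esub> e \<in> carrier E"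
    and \<theta>: "\<And>e. e \<in> carrier E \<Longrightarrow> \<theta> e \<in> carrier S"
    and \<theta>_add: "\<And>e e'. \<lbrakk>e \<in> carrier E; e' \<in> carrier E\<rbrakk> \<Longrightarrow> \<phi> (\<theta> (e \<oplus>\<^bsub>E\<^esub> e')) = \<phi> (\<theta> e) \<oplus>\<^bsub>B\<^esub> \<phi> (\<theta> e')"
    and \<theta>_smult: "\<And>s e. \<lbrakk>s \<in> carrier S; e \<in> carrier E\<rbrakk> \<Longrightarrow> \<phi> (\<theta> (s \<odot>\<^bsub>E\<^esub> e)) = \<phi> s \<otimes>\<^bsub>B\<^esub> \<phi> (\<theta> e)"
    and u: "u \<in> carrier E" "\<phi> (\<theta> u) = \<one>\<^bsub>B\<^esub>" "\<And>e. e \<in> carrier E \<Longrightarrow> \<theta> e \<odot>\<^bsub>E\<^esub> u = e"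
  shows "module_isomorphic B (left_regular B) (induced_module S B \<phi> E)"
proof -
  interpret B: ring B by (rule B)
  define U where "U = restrict_scalars \<phi> (right_regular B)"
  have U: "carrier U = carrier B" "add U = add B" "\<And>s x. s \<odot>\<^bsub>U\<^esub> x = x \<otimes>\<^bsub>B\<^esub> \<phi> s"
    by (simp_all add: U_def restrict_scalars_def right_regular_def left_regular_def opposite_def)
  interpret T: tensor_factors S U E
    by unfold_locales (simp_all add: U E_add E_smult \<phi>)
  interpret TG: comm_group T.T by (rule T.tensor_comm_group)
  \<comment> \<open>The candidate for the inverse of x \<mapsto> x \<otimes> u sends x \<otimes> e
    to x times the image in B of \<theta> e, the scalar that carries u to e.\<close>
  interpret b: balanced_map S U E "add_monoid B" "\<lambda>x e. x \<otimes>\<^bsub>B\<^esub> \<phi> (\<theta> e)"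
    by (intro balanced_map.intro balanced_map_axioms.intro T.tensor_factors_axioms B.a_comm_group)
      (simp_all add: U \<phi> \<theta> \<theta>_add \<theta>_smult B.l_distr B.r_distr B.m_assoc)
  define h where "h = tensor_lift (add_monoid B) (\<lambda>x e. x \<otimes>\<^bsub>B\<^esub> \<phi> (\<theta> e))"
  have h: "h \<in> hom T.T (add_monoid B)" unfolding h_def by (rule b.tensor_lift_hom)
  have h_pure: "h (T.pt x e) = x \<otimes>\<^bsub>B\<^esub> \<phi> (\<theta> e)" if "x \<in> carrier B" "e \<in> carrier E" for x e
    unfolding h_def using that by (intro b.tensor_lift_pure) (simp_all add: U)
  have h_closed: "h t \<in> carrier B" if "t \<in> carrier T.T" for t
    using hom_in_carrier[OF h that] by simp
  have balanced_smult: "balanced_map S U E T.T (\<lambda>x m. T.pt (b \<otimes>\<^bsub>B\<^esub> x) m)" if "b \<in> carrier B" for b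
    using that
    by (intro balanced_map.intro balanced_map_axioms.intro T.tensor_factors_axioms T.tensor_comm_group)
      (simp_all add: U \<phi> B.r_distr T.pure_tensor_add_left[unfolded U] T.pure_tensor_add_right[unfolded U]
        T.pure_tensor_balanced[unfolded U, symmetric] T.pure_tensor_closed[unfolded U] B.m_assoc)
  have retract: "T.pt (h t) u = t" if t: "t \<in> carrier T.T" for t
  proof (rule T.tensor_hom_eqI[where h = "\<lambda>t. T.pt (h t) u" and h' = "\<lambda>t. t"])
    show "group T.T" by (rule TG.is_group)
    show "(\<lambda>t. T.pt (h t) u) \<in> hom T.T T.T"
      by (rule homI) (simp_all add: h_closed u U T.pure_tensor_closed[unfolded U] hom_mult[OF h]
        T.pure_tensor_add_left[unfolded U])
    show "(\<lambda>t. t) \<in> hom T.T T.T" by (rule T.id_hom_tensor)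
    \<comment> \<open>Since \<theta> e carries u to e, balancing moves \<theta> e across the tensor
      sign, and x \<otimes> e becomes a tensor with right factor u.\<close>
    show "T.pt (h (T.pt x e)) u = T.pt x e" if "x \<in> carrier U" "e \<in> carrier E" for x e
      using that T.pure_tensor_balanced[of "\<theta> e" x u] u by (simp add: U h_pure \<theta>)
    show "t \<in> carrier T.T" by (rule t)
  qed
  have h_section: "h (T.pt x u) = x" if "x \<in> carrier B" for x
    using that u by (simp add: h_pure)
  let ?I = "induced_module S B \<phi> E"
  have I: "carrier ?I = carrier T.T" "add ?I = mult T.T"
    "\<And>b t. b \<odot>\<^bsub>?I\<^esub> t = tensor_lift T.T (\<lambda>x m. T.pt (b \<otimes>\<^bsub>B\<^esub> x) m) t"
    by (simp_all add: induced_module_def module_on_def Let_def U_def)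
  show ?thesis
    unfolding module_isomorphic_def
  proof (rule bexI[of _ "\<lambda>x\<in>carrier B. T.pt x u"])
    show "(\<lambda>x\<in>carrier B. T.pt x u) \<in> module_homs B (left_regular B) ?I"
      unfolding module_homs_def
      using u by (auto simp: I left_regular_def T.pure_tensor_closed[unfolded U]
          T.pure_tensor_add_left[unfolded U] balanced_map.tensor_lift_pure[OF balanced_smult] U)
    show "bij_betw (\<lambda>x\<in>carrier B. T.pt x u) (carrier (left_regular B)) (carrier ?I)"
      by (rule bij_betw_byWitness[where f' = h])
        (use u in \<open>auto simp: I left_regular_def h_closed retract h_section T.pure_tensor_closed[unfolded U]\<close>)
  qed
qed

section \<open>Transport of structure\<close>

text \<open>Surjectivity of h turns every law quantified over N into a law about images, which holds
  because its counterpart holds in M. N is a bare record of operations; the regular module, its copy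
  and the Hom space below all obtain their structure in this way.\<close>

lemma abelian_group_image:
  assumes M: "abelian_group M" and surj: "h ` carrier M = carrier N"
    and add: "\<And>x y. \<lbrakk>x \<in> carrier M; y \<in> carrier M\<rbrakk> \<Longrightarrow> h (x \<oplus>\<^bsub>M\<^esub> y) = h x \<oplus>\<^bsub>N\<^esub> h y"
    and zero: "h \<zero>\<^bsub>M\<^esub> = \<zero>\<^bsub>N\<^esub>"
  shows "abelian_group N"
proof -
  interpret M: abelian_group M by (rule M)
  have *: "(\<forall>x\<in>carrier N. P x) \<longleftrightarrow> (\<forall>a\<in>carrier M. P (h a))" for P
    unfolding surj[symmetric] by blast
  have closed: "h a \<in> carrier N" if "a \<in> carrier M" for a
    using that surj by blast
  have ex: "\<exists>b\<in>carrier M. h b \<oplus>\<^bsub>N\<^esub> h a = \<zero>\<^bsub>N\<^esub>" if "a \<in> carrier M" for a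
    by (rule bexI[of _ "\<ominus>\<^bsub>M\<^esub> a"])
      (use that in \<open>simp_all add: add[symmetric] zero M.l_neg\<close>)
  have "\<forall>x\<in>carrier N. \<forall>y\<in>carrier N. x \<oplus>\<^bsub>N\<^esub> y \<in> carrier N \<and> x \<oplus>\<^bsub>N\<^esub> y = y \<oplus>\<^bsub>N\<^esub> x"
    unfolding * by (simp add: add[symmetric] closed M.a_comm)
  moreover have "\<forall>x\<in>carrier N. \<forall>y\<in>carrier N. \<forall>z\<in>carrier N.
      x \<oplus>\<^bsub>N\<^esub> y \<oplus>\<^bsub>N\<^esub> z = x \<oplus>\<^bsub>N\<^esub> (y \<oplus>\<^bsub>N\<^esub> z)"
    unfolding * by (simp add: add[symmetric] M.a_assoc)
  moreover have "\<forall>x\<in>carrier N. \<zero>\<^bsub>N\<^esub> \<oplus>\<^bsub>N\<^esub> x = x"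
    unfolding * by (simp add: add[symmetric] zero[symmetric])
  moreover have "\<forall>x\<in>carrier N. \<exists>y\<in>carrier N. y \<oplus>\<^bsub>N\<^esub> x = \<zero>\<^bsub>N\<^esub>"
    unfolding * using ex closed by blast
  moreover have "\<zero>\<^bsub>N\<^esub> \<in> carrier N"
    unfolding zero[symmetric] by (simp add: closed)
  ultimately show ?thesis by (intro abelian_groupI) simp_all
qed

lemma left_module_image:
  assumes M: "left_module B M" and surj: "h ` carrier M = carrier N"
    and add: "\<And>x y. \<lbrakk>x \<in> carrier M; y \<in> carrier M\<rbrakk> \<Longrightarrow> h (x \<oplus>\<^bsub>M\<^esub> y) = h x \<oplus>\<^bsub>N\<^esub> h y"
    and zero: "h \<zero>\<^bsub>M\<^esub> = \<zero>\<^bsub>N\<^esub>"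
    and smult: "\<And>r x. \<lbrakk>r \<in> carrier B; x \<in> carrier M\<rbrakk> \<Longrightarrow> h (r \<odot>\<^bsub>M\<^esub> x) = r \<odot>\<^bsub>N\<^esub> h x"
  shows "left_module B N"
proof -
  interpret M: abelian_group M using M by (simp add: left_module_def)
  interpret B: ring B using M by (simp add: left_module_def)
  have N: "abelian_group N" using abelian_group_image[OF M.abelian_group_axioms surj add zero] .
  have *: "(\<forall>x\<in>carrier N. P x) \<longleftrightarrow> (\<forall>a\<in>carrier M. P (h a))" for P
    unfolding surj[symmetric] by blast
  have closed: "h a \<in> carrier N" if "a \<in> carrier M" for a
    using that surj by blast
  show ?thesis
    using M B.ring_axioms N unfolding left_module_def *
    by (simp add: add[symmetric] smult[symmetric] closed)
qed

lemma vectorspace_image: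
  fixes M :: "(complex, 'm) module" and N :: "(complex, 'n) module"
  assumes M: "vectorspace class_ring M" and surj: "h ` carrier M = carrier N"
    and add: "\<And>x y. \<lbrakk>x \<in> carrier M; y \<in> carrier M\<rbrakk> \<Longrightarrow> h (x \<oplus>\<^bsub>M\<^esub> y) = h x \<oplus>\<^bsub>N\<^esub> h y"
    and zero: "h \<zero>\<^bsub>M\<^esub> = \<zero>\<^bsub>N\<^esub>"
    and smult: "\<And>z x. x \<in> carrier M \<Longrightarrow> h (z \<odot>\<^bsub>M\<^esub> x) = z \<odot>\<^bsub>N\<^esub> h x"
  shows "vectorspace class_ring N"
proof -
  interpret M: vectorspace "class_ring :: complex ring" M by (rule M)
  have N: "abelian_group N" using abelian_group_image[OF M.abelian_group_axioms surj add zero] .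
  have *: "(\<forall>x\<in>carrier N. P x) \<longleftrightarrow> (\<forall>a\<in>carrier M. P (h a))" for P
    unfolding surj[symmetric] by blast
  have closed: "h a \<in> carrier N" if "a \<in> carrier M" for a
    using that surj by blast
  have 1: "\<forall>z. \<forall>x\<in>carrier N. z \<odot>\<^bsub>N\<^esub> x \<in> carrier N"
    unfolding * by (simp add: closed smult[symmetric] M.smult_closed[simplified])
  have 2: "\<forall>z w. \<forall>x\<in>carrier N. (z + w) \<odot>\<^bsub>N\<^esub> x = z \<odot>\<^bsub>N\<^esub> x \<oplus>\<^bsub>N\<^esub> w \<odot>\<^bsub>N\<^esub> x"
    unfolding * using M.smult_l_distr
    by (simp add: smult[symmetric] add[symmetric] M.smult_closed[simplified])
  have 3: "\<forall>z. \<forall>x\<in>carrier N. \<forall>y\<in>carrier N. z \<odot>\<^bsub>N\<^esub> (x \<oplus>\<^bsub>N\<^esub> y) = z \<odot>\<^bsub>N\<^esub> x \<oplus>\<^bsub>N\<^esub> z \<odot>\<^bsub>N\<^esub> y"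
    unfolding * using M.smult_r_distr
    by (simp add: smult[symmetric] add[symmetric] M.smult_closed[simplified])
  have 4: "\<forall>z w. \<forall>x\<in>carrier N. (z * w) \<odot>\<^bsub>N\<^esub> x = z \<odot>\<^bsub>N\<^esub> (w \<odot>\<^bsub>N\<^esub> x)"
    unfolding * using M.smult_assoc1
    by (simp add: smult[symmetric] M.smult_closed[simplified])
  have 5: "\<forall>x\<in>carrier N. 1 \<odot>\<^bsub>N\<^esub> x = x"
    unfolding * using M.smult_one by (simp add: smult[symmetric])
  have cring: "cring (class_ring :: complex ring)"
    using M by (simp add: vectorspace_def field_def domain_def)
  have "Module.module (class_ring :: complex ring) N"
    by (rule moduleI) (use 1 2 3 4 5 N cring in simp_all)
  then show ?thesis
    using M by (simp add: vectorspace_def)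
qed

text \<open>The vector space laws of N come from \<open>vectorspace_image\<close>, and then h is a
  linear bijection. For N a \<open>hom_space\<close> this yields the dimension with no separate
  check that homomorphisms form a vector space.\<close>

lemma vectorspace_dim_image:
  fixes M :: "(complex, 'm) module" and N :: "(complex, 'n) module"
  assumes M: "vectorspace class_ring M" "vectorspace.fin_dim class_ring M"
    and bij: "bij_betw h (carrier M) (carrier N)"
    and add: "\<And>x y. \<lbrakk>x \<in> carrier M; y \<in> carrier M\<rbrakk> \<Longrightarrow> h (x \<oplus>\<^bsub>M\<^esub> y) = h x \<oplus>\<^bsub>N\<^esub> h y"
    and zero: "h \<zero>\<^bsub>M\<^esub> = \<zero>\<^bsub>N\<^esub>"
    and smult: "\<And>z x. x \<in> carrier M \<Longrightarrow> h (z \<odot>\<^bsub>M\<^esub> x) = z \<odot>\<^bsub>N\<^esub> h x"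
  shows "vectorspace.dim class_ring N = vectorspace.dim class_ring M"
proof -
  have surj: "h ` carrier M = carrier N" using bij by (rule bij_betw_imp_surj_on)
  have N: "vectorspace class_ring N" using vectorspace_image[OF M(1) surj add zero smult] .
  have hom: "h \<in> LinearCombinations.module_hom class_ring M N"
    using surj add smult unfolding LinearCombinations.module_hom_def by auto
  have "linear_map class_ring M N h"
    using M(1) N hom by (simp add: linear_map_def mod_hom_def mod_hom_axioms_def vectorspace_def)
  from linear_map.dim_eq[OF this M(2) bij_betw_imp_inj_on[OF bij] surj] show ?thesis ..
qed

section \<open>Isomorphic modules and their classes\<close>

lemma module_isomorphic_trans:
  assumes "module_isomorphic B L M" "module_isomorphic B M N"
    and L: "\<And>x y. \<lbrakk>x \<in> carrier L; y \<in> carrier L\<rbrakk> \<Longrightarrow> x \<oplus>\<^bsub>L\<^esub> y \<in> carrier L"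
      "\<And>r x. \<lbrakk>r \<in> carrier B; x \<in> carrier L\<rbrakk> \<Longrightarrow> r \<odot>\<^bsub>L\<^esub> x \<in> carrier L"
  shows "module_isomorphic B L N"
proof -
  obtain f g where f: "f \<in> module_homs B L M" "bij_betw f (carrier L) (carrier M)"
    and g: "g \<in> module_homs B M N" "bij_betw g (carrier M) (carrier N)"
    using assms unfolding module_isomorphic_def by blast
  have closed: "f x \<in> carrier M" if "x \<in> carrier L" for x
    using f that unfolding module_homs_def by auto
  have "bij_betw (restrict (g \<circ> f) (carrier L)) (carrier L) (carrier N)"
    using bij_betw_trans[OF f(2) g(2)] by simp
  moreover have "restrict (g \<circ> f) (carrier L) \<in> module_homs B L N"
    using f g closed L unfolding module_homs_def by (auto simp: PiE_iff)
  ultimately show ?thesis unfolding module_isomorphic_def by blast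
qed

lemma module_isomorphic_sym:
  assumes "module_isomorphic B L M"
    and L: "\<And>x y. \<lbrakk>x \<in> carrier L; y \<in> carrier L\<rbrakk> \<Longrightarrow> x \<oplus>\<^bsub>L\<^esub> y \<in> carrier L"
      "\<And>r x. \<lbrakk>r \<in> carrier B; x \<in> carrier L\<rbrakk> \<Longrightarrow> r \<odot>\<^bsub>L\<^esub> x \<in> carrier L"
  shows "module_isomorphic B M L"
proof -
  obtain f where f: "f \<in> module_homs B L M" "bij_betw f (carrier L) (carrier M)"
    using assms unfolding module_isomorphic_def by blast
  let ?g = "restrict (inv_into (carrier L) f) (carrier M)"
  have surj: "carrier M = f ` carrier L" using f(2) by (simp add: bij_betw_imp_surj_on)
  have inv: "inv_into (carrier L) f (f x) = x" if "x \<in> carrier L" for x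
    using f(2) that by (simp add: bij_betw_def)
  have hom: "f (x \<oplus>\<^bsub>L\<^esub> y) = f x \<oplus>\<^bsub>M\<^esub> f y" "r \<in> carrier B \<Longrightarrow> f (r \<odot>\<^bsub>L\<^esub> x) = r \<odot>\<^bsub>M\<^esub> f x"
    if "x \<in> carrier L" "y \<in> carrier L" for x y r
    using f(1) that unfolding module_homs_def by auto
  have "?g \<in> module_homs B M L"
    unfolding module_homs_def surj by (auto simp: inv L hom[symmetric])
  moreover have "bij_betw ?g (carrier M) (carrier L)"
    using bij_betw_inv_into[OF f(2)] by simp
  ultimately show ?thesis unfolding module_isomorphic_def by blast
qed

text \<open>\<open>mclass\<close> picks, by \<open>SOME\<close>, a module among those isomorphic to
  its argument. Isomorphic arguments define the same predicate, so even the chosen module is the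
  same; this covers L and M with elements of different types.\<close>

lemma mclass_cong:
  assumes iso: "module_isomorphic B L M"
    and L: "\<And>x y. \<lbrakk>x \<in> carrier L; y \<in> carrier L\<rbrakk> \<Longrightarrow> x \<oplus>\<^bsub>L\<^esub> y \<in> carrier L"
      "\<And>r x. \<lbrakk>r \<in> carrier B; x \<in> carrier L\<rbrakk> \<Longrightarrow> r \<odot>\<^bsub>L\<^esub> x \<in> carrier L"
  shows "mclass \<kappa> B L = mclass \<kappa> B M"
proof -
  obtain f where f: "f \<in> module_homs B L M" "f ` carrier L = carrier M"
    using iso unfolding module_isomorphic_def bij_betw_def by blast
  \<comment> \<open>Closure is transported along f so that \<open>module_isomorphic_trans\<close>
    can also be applied with M as the first module.\<close>
  have M: "x \<oplus>\<^bsub>M\<^esub> y \<in> carrier M" "r \<in> carrier B \<Longrightarrow> r \<odot>\<^bsub>M\<^esub> x \<in> carrier M"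
    if "x \<in> carrier M" "y \<in> carrier M" for x y r
  proof -
    obtain a b where ab: "a \<in> carrier L" "b \<in> carrier L" "x = f a" "y = f b"
      using \<open>x \<in> carrier M\<close> \<open>y \<in> carrier M\<close> f(2) by blast
    then have "x \<oplus>\<^bsub>M\<^esub> y = f (a \<oplus>\<^bsub>L\<^esub> b)" "r \<in> carrier B \<Longrightarrow> r \<odot>\<^bsub>M\<^esub> x = f (r \<odot>\<^bsub>L\<^esub> a)"
      using f(1) unfolding module_homs_def by auto
    then show "x \<oplus>\<^bsub>M\<^esub> y \<in> carrier M" "r \<in> carrier B \<Longrightarrow> r \<odot>\<^bsub>M\<^esub> x \<in> carrier M"
      using ab f(2) L by auto
  qed
  have "module_isomorphic B L N \<longleftrightarrow> module_isomorphic B M N" for N :: "('a, nat \<Rightarrow> complex) module"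
  proof
    assume "module_isomorphic B L N"
    then show "module_isomorphic B M N"
      by (intro module_isomorphic_trans[OF module_isomorphic_sym[OF iso L]] M)
  next
    assume "module_isomorphic B M N"
    then show "module_isomorphic B L N"
      by (intro module_isomorphic_trans[OF iso] L)
  qed
  then show ?thesis by (simp add: mclass_def)
qed

text \<open>The witness M' guarantees that the choice inside \<open>mclass\<close> falls into
  \<open>modules_in\<close>, so that the coset is an element of the quotient.\<close>

lemma mclass_closed:
  assumes "module_isomorphic B M M'" "M' \<in> modules_in \<kappa> B"
  shows "mclass \<kappa> B M \<in> carrier (grothendieck \<kappa> B)"
proof -
  have "(SOME M'. M' \<in> modules_in \<kappa> B \<and> module_isomorphic B M M') \<in> modules_in \<kappa> B"
    using someI_ex[of "\<lambda>M'. M' \<in> modules_in \<kappa> B \<and> module_isomorphic B M M'"] assms by blast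
  then show ?thesis
    unfolding mclass_def grothendieck_def FactGroup_def RCOSETS_def by force
qed

section \<open>Regular modules with elements in \<open>nat \<Rightarrow> complex\<close>\<close>

locale fin_dim_algebra =
  fixes B :: "(complex, 'b) module"
  assumes fd: "fd_algebra B"
begin

lemma alg_ring: "ring B" and alg_vectorspace: "vectorspace class_ring B"
  and alg_fin_dim: "vectorspace.fin_dim class_ring B"
  using fd by (auto simp: fd_algebra_def)

sublocale B: ring B by (rule alg_ring)

lemma alg_module: "Module.module (class_ring :: complex ring) B"
  using alg_vectorspace by (simp add: vectorspace_def)

lemma scale_closed [simp]: "x \<in> carrier B \<Longrightarrow> z \<odot>\<^bsub>B\<^esub> x \<in> carrier B"
  using module.smult_closed[OF alg_module] by simp

lemma scale_mult_left: "\<lbrakk>x \<in> carrier B; y \<in> carrier B\<rbrakk> \<Longrightarrow>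
    (z \<odot>\<^bsub>B\<^esub> x) \<otimes>\<^bsub>B\<^esub> y = z \<odot>\<^bsub>B\<^esub> (x \<otimes>\<^bsub>B\<^esub> y)"
  and scale_mult_right: "\<lbrakk>x \<in> carrier B; y \<in> carrier B\<rbrakk> \<Longrightarrow>
    x \<otimes>\<^bsub>B\<^esub> (z \<odot>\<^bsub>B\<^esub> y) = z \<odot>\<^bsub>B\<^esub> (x \<otimes>\<^bsub>B\<^esub> y)"
  using fd by (auto simp: fd_algebra_def)

lemma left_regular_simps [simp]:
  "carrier (left_regular B) = carrier B" "add (left_regular B) = add B"
  "zero (left_regular B) = zero B" "r \<odot>\<^bsub>left_regular B\<^esub> x = r \<otimes>\<^bsub>B\<^esub> x"
  by (simp_all add: left_regular_def)

lemma left_regular_module: "left_module B (left_regular B)"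
  unfolding left_module_def
  using B.ring_axioms abelian_group_image[OF B.abelian_group_axioms, of "\<lambda>x. x" "left_regular B"]
  by (simp add: B.l_distr B.r_distr B.m_assoc)

text \<open>An element is determined by coefficients that express it over a finite spanning set, and
  numbering this set turns them into a function on the naturals. The coefficients are chosen
  arbitrarily, so the injection may fail to be linear.\<close>

lemma ex_injection: "\<exists>\<iota> :: 'b \<Rightarrow> nat \<Rightarrow> complex. inj_on \<iota> (carrier B)"
proof -
  interpret V: vectorspace "class_ring :: complex ring" B by (rule alg_vectorspace)
  obtain S where S: "finite S" "S \<subseteq> carrier B" "V.span S = carrier B"
    using alg_fin_dim unfolding V.fin_dim_def by blast
  obtain e where e: "bij_betw e {0..<card S} S"
    using ex_bij_betw_nat_finite[OF S(1)] by blast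
  have "\<forall>x\<in>carrier B. \<exists>c. x = V.lincomb c S"
    using S V.finite_span[OF S(1,2)] by auto
  from bchoice[OF this] obtain c where c: "\<forall>x\<in>carrier B. x = V.lincomb (c x) S" ..
  have "inj_on (\<lambda>x n. c x (e n)) (carrier B)"
  proof (rule inj_onI)
    fix x y assume xy: "x \<in> carrier B" "y \<in> carrier B" and eq: "(\<lambda>n. c x (e n)) = (\<lambda>n. c y (e n))"
    have "c x s = c y s" if "s \<in> S" for s
    proof -
      have "s \<in> e ` {0..<card S}" using that bij_betw_imp_surj_on[OF e] by simp
      then obtain n where "s = e n" by (rule imageE)
      then show ?thesis using fun_cong[OF eq, of n] by simp
    qed
    then have eq': "V.lincomb (c x) S = V.lincomb (c y) S"
      unfolding V.lincomb_def using S(2) by (intro B.finsum_cong') auto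
    show "x = y"
      using bspec[OF c xy(1)] eq' bspec[OF c xy(2), symmetric] by (rule trans[OF trans])
  qed
  then show ?thesis by blast
qed

definition embedding :: "'b \<Rightarrow> nat \<Rightarrow> complex" where
  "embedding = (SOME \<iota>. inj_on \<iota> (carrier B))"

lemma inj_embedding: "inj_on embedding (carrier B)"
  unfolding embedding_def using someI_ex[OF ex_injection] .

definition coord :: "(nat \<Rightarrow> complex) \<Rightarrow> 'b" where
  "coord = inv_into (carrier B) embedding"

text \<open>As \<open>embedding\<close> is merely injective, the operations are transported along
  it; they are unrelated to the pointwise operations on functions.\<close>

definition regular_copy :: "('b, nat \<Rightarrow> complex) module" where
  "regular_copy = \<lparr>carrier = embedding ` carrier B, mult = undefined, one = undefined,
     zero = embedding \<zero>\<^bsub>B\<^esub>, add = (\<lambda>x y. embedding (coord x \<oplus>\<^bsub>B\<^esub> coord y)),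
     smult = (\<lambda>b x. embedding (b \<otimes>\<^bsub>B\<^esub> coord x))\<rparr>"

lemma coord_embedding [simp]: "b \<in> carrier B \<Longrightarrow> coord (embedding b) = b"
  unfolding coord_def using inj_embedding by simp

lemma regular_copy_simps:
  "carrier regular_copy = embedding ` carrier B" "\<zero>\<^bsub>regular_copy\<^esub> = embedding \<zero>\<^bsub>B\<^esub>"
  "x \<oplus>\<^bsub>regular_copy\<^esub> y = embedding (coord x \<oplus>\<^bsub>B\<^esub> coord y)"
  "b \<odot>\<^bsub>regular_copy\<^esub> x = embedding (b \<otimes>\<^bsub>B\<^esub> coord x)"
  by (simp_all add: regular_copy_def)

lemma regular_copy_module: "left_module B regular_copy"
  by (rule left_module_image[OF left_regular_module, of embedding])
    (simp_all add: regular_copy_simps)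

lemma regular_copy_finitely_generated: "finitely_generated_module B regular_copy"
proof -
  interpret M: abelian_group regular_copy
    using regular_copy_module by (simp add: left_module_def)
  have mem: "embedding x \<in> carrier regular_copy" if "x \<in> carrier B" for x
    using that by (simp add: regular_copy_simps)
  show ?thesis
    unfolding finitely_generated_module_def
  proof (intro exI[of _ "{embedding \<one>\<^bsub>B\<^esub>}"] conjI ballI)
    show "finite {embedding \<one>\<^bsub>B\<^esub>}" by simp
    show "{embedding \<one>\<^bsub>B\<^esub>} \<subseteq> carrier regular_copy" using mem by simp
    fix x assume "x \<in> carrier regular_copy"
    then obtain b where b: "b \<in> carrier B" "x = embedding b" by (auto simp: regular_copy_simps)
    show "\<exists>c\<in>{embedding \<one>\<^bsub>B\<^esub>} \<rightarrow> carrier B. x = (\<Oplus>\<^bsub>regular_copy\<^esub>s\<in>{embedding \<one>\<^bsub>B\<^esub>}. c s \<odot>\<^bsub>regular_copy\<^esub> s)"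
      by (rule bexI[of _ "\<lambda>_. b"])
        (use b mem in \<open>simp_all add: M.finsum_insert regular_copy_simps(4)\<close>)
  qed
qed

lemma regular_copy_projective: "projective_module B regular_copy"
proof -
  \<comment> \<open>\<open>projective_module\<close> asks for an index set inside the type of
    elements, here \<open>nat \<Rightarrow> complex\<close>. Any singleton yields a free module of
    rank one, to which the copy is isomorphic.\<close>
  define i where "i = embedding \<one>\<^bsub>B\<^esub>"
  have free: "carrier (free_module B {i}) = {i} \<rightarrow>\<^sub>E carrier B"
    "x \<oplus>\<^bsub>free_module B {i}\<^esub> y = (\<lambda>j\<in>{i}. x j \<oplus>\<^bsub>B\<^esub> y j)"
    "r \<odot>\<^bsub>free_module B {i}\<^esub> x = (\<lambda>j\<in>{i}. r \<otimes>\<^bsub>B\<^esub> x j)" for x y r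
    by (auto simp: free_module_def)
  show ?thesis
    unfolding projective_module_def
  proof (intro conjI exI[of _ "{i}"] bexI)
    show "left_module B regular_copy" by (rule regular_copy_module)
    show "\<forall>x\<in>carrier regular_copy. (\<lambda>f\<in>carrier (free_module B {i}). embedding (f i))
        ((\<lambda>x\<in>carrier regular_copy. \<lambda>j\<in>{i}. coord x) x) = x"
      by (auto simp: regular_copy_simps free)
    show "(\<lambda>f\<in>carrier (free_module B {i}). embedding (f i)) \<in> module_homs B (free_module B {i}) regular_copy"
      by (auto simp: module_homs_def regular_copy_simps free PiE_iff)
    show "(\<lambda>x\<in>carrier regular_copy. \<lambda>j\<in>{i}. coord x) \<in> module_homs B regular_copy (free_module B {i})"
      by (auto simp: module_homs_def regular_copy_simps free PiE_iff intro!: restrict_ext)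
  qed
qed

lemma regular_copy_modules_in: "regular_copy \<in> modules_in \<kappa> B"
  unfolding modules_in_def
  using regular_copy_module regular_copy_finitely_generated regular_copy_projective by simp

lemma regular_copy_isomorphic: "module_isomorphic B (left_regular B) regular_copy"
  unfolding module_isomorphic_def
proof (rule bexI[of _ "restrict embedding (carrier B)"])
  show "restrict embedding (carrier B) \<in> module_homs B (left_regular B) regular_copy"
    by (auto simp: module_homs_def regular_copy_simps)
  show "bij_betw (restrict embedding (carrier B)) (carrier (left_regular B)) (carrier regular_copy)"
    using inj_embedding by (simp add: bij_betw_def regular_copy_simps inj_on_def)
qed

lemma mclass_regular_copy: "mclass \<kappa> B regular_copy = mclass \<kappa> B (left_regular B)"
  by (rule mclass_cong[OF regular_copy_isomorphic, symmetric]) simp_all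

text \<open>An endomorphism of the regular module is right multiplication by the image of \<open>1\<close>.\<close>

lemma dim_hom_space_regular_copy:
  "vectorspace.dim class_ring (hom_space B regular_copy regular_copy) = vectorspace.dim class_ring B"
proof (rule vectorspace_dim_image[OF alg_vectorspace alg_fin_dim])
  define h where "h a = (\<lambda>x\<in>carrier regular_copy. embedding (coord x \<otimes>\<^bsub>B\<^esub> a))" for a
  show "bij_betw h (carrier B) (carrier (hom_space B regular_copy regular_copy))"
  proof (rule bij_betw_byWitness[where f' = "\<lambda>f. coord (f (embedding \<one>\<^bsub>B\<^esub>))"])
    show "\<forall>a\<in>carrier B. coord (h a (embedding \<one>\<^bsub>B\<^esub>)) = a"
      by (auto simp: h_def regular_copy_simps)
    show "h ` carrier B \<subseteq> carrier (hom_space B regular_copy regular_copy)"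
      by (auto simp: h_def hom_space_def module_homs_def regular_copy_simps B.l_distr B.m_assoc)
    have f: "f (embedding \<one>\<^bsub>B\<^esub>) \<in> embedding ` carrier B"
      "\<And>r x. \<lbrakk>r \<in> carrier B; x \<in> carrier B\<rbrakk> \<Longrightarrow> f (embedding (r \<otimes>\<^bsub>B\<^esub> x)) = embedding (r \<otimes>\<^bsub>B\<^esub> coord (f (embedding x)))"
      "f \<in> extensional (carrier regular_copy)"
      if "f \<in> module_homs B regular_copy regular_copy" for f
      using that by (auto simp: module_homs_def regular_copy_simps PiE_iff)
    show "(\<lambda>f. coord (f (embedding \<one>\<^bsub>B\<^esub>))) ` carrier (hom_space B regular_copy regular_copy) \<subseteq> carrier B"
      using f(1) by (fastforce simp: hom_space_def)
    show "\<forall>f\<in>carrier (hom_space B regular_copy regular_copy). h (coord (f (embedding \<one>\<^bsub>B\<^esub>))) = f"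
    proof
      fix f assume "f \<in> carrier (hom_space B regular_copy regular_copy)"
      then have *: "f \<in> module_homs B regular_copy regular_copy" by (simp add: hom_space_def)
      show "h (coord (f (embedding \<one>\<^bsub>B\<^esub>))) = f"
        unfolding h_def
      proof (rule extensionalityI[OF restrict_extensional f(3)[OF *]])
        fix x assume "x \<in> carrier regular_copy"
        then obtain b where b: "b \<in> carrier B" "x = embedding b" by (auto simp: regular_copy_simps)
        have "embedding (b \<otimes>\<^bsub>B\<^esub> coord (f (embedding \<one>\<^bsub>B\<^esub>))) = f (embedding b)"
          unfolding f(2)[OF * b(1) B.one_closed, symmetric] B.r_one[OF b(1)] ..
        then show "(\<lambda>x\<in>carrier regular_copy. embedding (coord x \<otimes>\<^bsub>B\<^esub> coord (f (embedding \<one>\<^bsub>B\<^esub>)))) x = f x"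
          using b by (simp add: regular_copy_simps)
      qed
    qed
  qed
  show "h (a \<oplus>\<^bsub>B\<^esub> b) = h a \<oplus>\<^bsub>hom_space B regular_copy regular_copy\<^esub> h b"
    if "a \<in> carrier B" "b \<in> carrier B" for a b
    using that by (auto simp: h_def hom_space_def regular_copy_simps B.r_distr fun_eq_iff)
  show "h \<zero>\<^bsub>B\<^esub> = \<zero>\<^bsub>hom_space B regular_copy regular_copy\<^esub>"
    by (auto simp: h_def hom_space_def regular_copy_simps fun_eq_iff)
  \<comment> \<open>\<open>hom_space\<close> lets z act by left multiplication with z times the
    unit, whereas h multiplies by z a on the right; the two agree because scalars commute with
    products.\<close>
  show "h (z \<odot>\<^bsub>B\<^esub> a) = z \<odot>\<^bsub>hom_space B regular_copy regular_copy\<^esub> h a" if "a \<in> carrier B" for z a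
    using that by (auto simp: h_def hom_space_def regular_copy_simps scale_mult_left scale_mult_right fun_eq_iff)
qed

end

section \<open>Induction of regular modules\<close>

locale two_algebras = B: fin_dim_algebra B + C: fin_dim_algebra C
  for B :: "(complex, 'b) module" and C :: "(complex, 'c) module"
begin

abbreviation "V \<equiv> underlying_space B B.regular_copy"
abbreviation "W \<equiv> underlying_space C C.regular_copy"

lemma space_simps:
  "carrier V = B.embedding ` carrier B" "carrier W = C.embedding ` carrier C"
  "x \<oplus>\<^bsub>V\<^esub> y = B.embedding (B.coord x \<oplus>\<^bsub>B\<^esub> B.coord y)"
  "x \<oplus>\<^bsub>W\<^esub> y = C.embedding (C.coord x \<oplus>\<^bsub>C\<^esub> C.coord y)"
  "z \<odot>\<^bsub>V\<^esub> x = B.embedding ((z \<odot>\<^bsub>B\<^esub> \<one>\<^bsub>B\<^esub>) \<otimes>\<^bsub>B\<^esub> B.coord x)"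
  "z \<odot>\<^bsub>W\<^esub> x = C.embedding ((z \<odot>\<^bsub>C\<^esub> \<one>\<^bsub>C\<^esub>) \<otimes>\<^bsub>C\<^esub> C.coord x)"
  by (simp_all add: underlying_space_def restrict_scalars_def B.regular_copy_simps C.regular_copy_simps)

text \<open>The same locale is instantiated twice: here \<open>act\<close> is the multiplication of
  \<open>algebra_tensor B C\<close>, in the next instance it is the action on the external tensor
  product of the two copies.\<close>

sublocale A: tensor_action "class_ring :: complex ring" B C B C "mult B" "mult C"
  by unfold_locales
    (simp_all add: B.B.l_distr B.B.r_distr C.B.l_distr C.B.r_distr B.scale_mult_left B.scale_mult_right
      C.scale_mult_left C.scale_mult_right)

sublocale E: tensor_action "class_ring :: complex ring" B C V W
  "smult B.regular_copy" "smult C.regular_copy"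
  by unfold_locales
    (auto simp: space_simps B.regular_copy_simps C.regular_copy_simps
      B.B.l_distr B.B.r_distr C.B.l_distr C.B.r_distr B.scale_mult_left B.scale_mult_right
      C.scale_mult_left C.scale_mult_right)

lemma algebra_tensor_simps:
  "carrier (algebra_tensor B C) = carrier A.S.T" "add (algebra_tensor B C) = mult A.S.T"
  "\<one>\<^bsub>algebra_tensor B C\<^esub> = A.S.pt \<one>\<^bsub>B\<^esub> \<one>\<^bsub>C\<^esub>" "mult (algebra_tensor B C) = A.act"
  by (simp_all add: tensor_algebra_def Let_def fun_eq_iff A.act_def)

abbreviation "ET \<equiv> external_tensor B C B.regular_copy C.regular_copy"

lemma external_tensor_simps:
  "carrier ET = carrier E.V.T" "add ET = mult E.V.T" "smult ET = E.act"
  by (simp_all add: external_tensor_def module_on_def Let_def fun_eq_iff E.act_def)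

text \<open>The external tensor product of the copies is free of rank one over
  \<open>algebra_tensor B C\<close>: undoing both embeddings gives \<theta>, and u, the copy of 1
  \<otimes> 1, is the generator. Inducing a free module of rank one along \<phi> returns the regular
  module of D.\<close>

lemma induced_external_tensor_regular:
  assumes D: "ring D" and \<phi>: "\<phi> \<in> ring_hom (algebra_tensor B C) D"
  shows "module_isomorphic D (left_regular D) (induced_module (algebra_tensor B C) D \<phi> ET)"
proof -
  interpret ST: comm_group A.S.T by (rule A.S.tensor_comm_group)
  interpret ETG: comm_group E.V.T by (rule E.V.tensor_comm_group)
  interpret t: balanced_map "class_ring :: complex ring" V W A.S.T "\<lambda>x y. A.S.pt (B.coord x) (C.coord y)"
  proof (intro balanced_map.intro balanced_map_axioms.intro E.V.tensor_factors_axioms ST.comm_group_axioms)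
  qed (auto simp: space_simps A.S.pure_tensor_add_left A.S.pure_tensor_add_right
      B.scale_mult_left C.scale_mult_left A.S.pure_tensor_balanced)
  define \<theta> where "\<theta> = tensor_lift A.S.T (\<lambda>x y. A.S.pt (B.coord x) (C.coord y))"
  have \<theta>: "\<theta> \<in> hom E.V.T A.S.T" unfolding \<theta>_def by (rule t.tensor_lift_hom)
  have \<theta>_pure: "\<theta> (E.V.pt (B.embedding b) (C.embedding c)) = A.S.pt b c"
    if "b \<in> carrier B" "c \<in> carrier C" for b c
    unfolding \<theta>_def using that by (subst t.tensor_lift_pure) (auto simp: space_simps)
  have \<theta>_closed: "\<theta> e \<in> carrier A.S.T" if "e \<in> carrier E.V.T" for e
    using hom_in_carrier[OF \<theta> that] .
  \<comment> \<open>Equivariance takes two passes, one for each argument: with a pure scalar both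
    sides are homomorphisms in e, and \<open>\<theta>_act\<close> then treats them as homomorphisms
    in the scalar.\<close>
  have \<theta>_act_pure: "\<theta> (E.act (A.S.pt b c) e) = A.act (A.S.pt b c) (\<theta> e)"
    if bc: "b \<in> carrier B" "c \<in> carrier C" and e: "e \<in> carrier E.V.T" for b c e
  proof (rule E.V.tensor_hom_eqI[where h = "\<lambda>e. \<theta> (E.act (A.S.pt b c) e)"
        and h' = "\<lambda>e. A.act (A.S.pt b c) (\<theta> e)", OF ST.is_group])
    show "(\<lambda>e. \<theta> (E.act (A.S.pt b c) e)) \<in> hom E.V.T A.S.T"
      using hom_compose[OF E.act_hom_right \<theta>] bc by (simp add: comp_def)
    show "(\<lambda>e. A.act (A.S.pt b c) (\<theta> e)) \<in> hom E.V.T A.S.T"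
      using hom_compose[OF \<theta> A.act_hom_right] bc by (simp add: comp_def)
    show "\<theta> (E.act (A.S.pt b c) (E.V.pt x y)) = A.act (A.S.pt b c) (\<theta> (E.V.pt x y))"
      if "x \<in> carrier V" "y \<in> carrier W" for x y
    proof -
      obtain b' c' where "b' \<in> carrier B" "c' \<in> carrier C" "x = B.embedding b'" "y = C.embedding c'"
        using \<open>x \<in> carrier V\<close> \<open>y \<in> carrier W\<close> by (auto simp: space_simps)
      then show ?thesis
        using bc by (subst E.act_pure)
          (auto simp: space_simps B.regular_copy_simps C.regular_copy_simps \<theta>_pure A.act_pure)
    qed
    show "e \<in> carrier E.V.T" by (rule e)
  qed
  have \<theta>_act: "\<theta> (E.act s e) = A.act s (\<theta> e)" if s: "s \<in> carrier A.S.T" and e: "e \<in> carrier E.V.T" for s e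
  proof (rule A.S.tensor_hom_eqI[where h = "\<lambda>s. \<theta> (E.act s e)"
        and h' = "\<lambda>s. A.act s (\<theta> e)", OF ST.is_group])
    show "(\<lambda>s. \<theta> (E.act s e)) \<in> hom A.S.T A.S.T"
      using hom_compose[OF E.act_hom_left[OF e] \<theta>] by (simp add: comp_def)
    show "(\<lambda>s. A.act s (\<theta> e)) \<in> hom A.S.T A.S.T"
      using A.act_hom_left[OF \<theta>_closed[OF e]] .
  qed (use s e \<theta>_act_pure in auto)
  define u where "u = E.V.pt (B.embedding \<one>\<^bsub>B\<^esub>) (C.embedding \<one>\<^bsub>C\<^esub>)"
  have u: "u \<in> carrier E.V.T" unfolding u_def by (rule E.V.pure_tensor_closed) (simp_all add: space_simps)
  have retract: "E.act (\<theta> e) u = e" if e: "e \<in> carrier E.V.T" for e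
  proof (rule E.V.tensor_hom_eqI[where h = "\<lambda>e. E.act (\<theta> e) u" and h' = "\<lambda>e. e", OF ETG.is_group])
    show "(\<lambda>e. E.act (\<theta> e) u) \<in> hom E.V.T E.V.T"
      using hom_compose[OF \<theta> E.act_hom_left[OF u]] by (simp add: comp_def)
    show "(\<lambda>e. e) \<in> hom E.V.T E.V.T" by (rule E.V.id_hom_tensor)
    show "E.act (\<theta> (E.V.pt x y)) u = E.V.pt x y" if "x \<in> carrier V" "y \<in> carrier W" for x y
    proof -
      obtain b c where bc: "b \<in> carrier B" "c \<in> carrier C" "x = B.embedding b" "y = C.embedding c"
        using \<open>x \<in> carrier V\<close> \<open>y \<in> carrier W\<close> by (auto simp: space_simps)
      then show ?thesis
        unfolding u_def by (simp add: \<theta>_pure, subst E.act_pure)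
          (auto simp: space_simps B.regular_copy_simps C.regular_copy_simps)
    qed
    show "e \<in> carrier E.V.T" by (rule e)
  qed
  show ?thesis
  proof (rule induced_regular_module_isomorphic[OF D, where \<theta> = \<theta> and u = u])
    show "\<phi> s \<in> carrier D" if "s \<in> carrier (algebra_tensor B C)" for s
      using ring_hom_closed[OF \<phi> that] .
    show "\<phi> (\<theta> (e \<oplus>\<^bsub>ET\<^esub> e')) = \<phi> (\<theta> e) \<oplus>\<^bsub>D\<^esub> \<phi> (\<theta> e')"
      if "e \<in> carrier ET" "e' \<in> carrier ET" for e e'
      using that ring_hom_add[OF \<phi>, of "\<theta> e" "\<theta> e'"] hom_mult[OF \<theta>, of e e']
      by (simp add: external_tensor_simps algebra_tensor_simps \<theta>_closed)
    show "\<phi> (\<theta> (s \<odot>\<^bsub>ET\<^esub> e)) = \<phi> s \<otimes>\<^bsub>D\<^esub> \<phi> (\<theta> e)"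
      if "s \<in> carrier (algebra_tensor B C)" "e \<in> carrier ET" for s e
      using that ring_hom_mult[OF \<phi>, of s "\<theta> e"]
      by (simp add: external_tensor_simps algebra_tensor_simps \<theta>_closed \<theta>_act)
    show "\<phi> (\<theta> u) = \<one>\<^bsub>D\<^esub>"
      using ring_hom_one[OF \<phi>] unfolding u_def by (simp add: \<theta>_pure algebra_tensor_simps)
  qed (simp_all add: external_tensor_simps algebra_tensor_simps \<theta>_closed u retract E.act_closed)
qed

end

section \<open>Primitive elements of graded connected Hopf algebras\<close>

context abelian_group
begin

lemma
  fixes k l :: int
  assumes "x \<in> carrier G"
  shows add_pow_int_closed: "[k] \<cdot> x \<in> carrier G"
    and add_pow_int_add: "[(k + l)] \<cdot> x = [k] \<cdot> x \<oplus> [l] \<cdot> x"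
    and add_pow_int_mult: "[(k * l)] \<cdot> x = [k] \<cdot> ([l] \<cdot> x)"
    and add_pow_int_0: "[(0::int)] \<cdot> x = \<zero>"
    and add_pow_int_1: "[(1::int)] \<cdot> x = x"
  using assms group.int_pow_closed[OF a_group, of x k] group.int_pow_mult[OF a_group, of x k l]
    group.int_pow_pow[OF a_group, of x l k]
    group.int_pow_1[OF a_group, of x]
  by (simp_all add: add_pow_def mult.commute)

lemma add_pow_int_distrib:
  fixes k :: int
  assumes "x \<in> carrier G" "y \<in> carrier G"
  shows "[k] \<cdot> (x \<oplus> y) = [k] \<cdot> x \<oplus> [k] \<cdot> y"
  using assms comm_group.int_pow_distrib[OF a_comm_group, of x y k] by (simp add: add_pow_def)

lemma hom_add_pow_int:
  fixes k :: int
  assumes h: "h \<in> hom (add_monoid G) K" and K: "group K" and x: "x \<in> carrier G"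
  shows "h ([k] \<cdot> x) = h x [^]\<^bsub>K\<^esub> k"
proof -
  interpret h: group_hom "add_monoid G" K h
    by (intro group_hom.intro group_hom_axioms.intro h K a_group)
  show ?thesis using h.hom_int_pow[of x k] x by (simp add: add_pow_def)
qed

end

text \<open>\<open>generate\<close> sees a record only through carrier, product and unit, which also
  fix the inverse. The grading axiom for the coproduct uses
  \<open>add_monoid (tensor_square H)\<close>, while the tensor lemmas use
  \<open>tensor\<close>.\<close>

lemma generate_mono_structure:
  assumes "carrier G = carrier G'" "mult G = mult G'" "one G = one G'" and x: "x \<in> generate G S"
  shows "x \<in> generate G' S"
  using x
proof induction
  case (inv h)
  have "inv\<^bsub>G\<^esub> h = inv\<^bsub>G'\<^esub> h" using assms by (simp add: m_inv_def)
  then show ?case using inv by (simp add: generate.inv)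
qed (use assms in \<open>auto intro: generate.intros\<close>)

locale graded_connected_hopf =
  fixes H :: "'h hopf" (structure) and D :: "nat \<Rightarrow> 'h set"
  assumes graded: "graded_hopf_algebra H D" and conn: "connected_hopf_algebra H D"
begin

lemmas graded_unfolded = graded[unfolded graded_hopf_algebra_def]
lemmas hopf_unfolded = graded_unfolded[THEN conjunct1, unfolded hopf_algebra_def]

lemma hopf_ring: "ring H"
  by (rule hopf_unfolded[THEN conjunct1])

sublocale ring H by (rule hopf_ring)

abbreviation "IA \<equiv> int_algebra H"

lemma int_algebra_simps [simp]:
  "carrier IA = carrier H" "mult IA = mult H" "one IA = one H" "zero IA = zero H" "add IA = add H"
  "k \<odot>\<^bsub>IA\<^esub> x = [k] \<cdot> x"
  by (simp_all add: int_algebra_def)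

sublocale act: tensor_action \<Z> IA IA IA IA "mult H" "mult H"
  by unfold_locales
    (simp_all add: add_pow_int_closed l_distr r_distr add_pow_ldistr_int add_pow_rdistr_int)

abbreviation "TT \<equiv> tensor \<Z> IA IA"
abbreviation "pp \<equiv> pure_tensor \<Z> IA IA"

lemma tensor_square_simps:
  "carrier (tensor_square H) = carrier TT" "add (tensor_square H) = mult TT"
  "mult (tensor_square H) = act.act"
  by (simp_all add: tensor_square_def tensor_algebra_def Let_def fun_eq_iff act.act_def)

lemma comult_hom: "comult H \<in> ring_hom H (tensor_square H)"
  by (rule hopf_unfolded[THEN conjunct2, THEN conjunct1])

lemma comult_closed: "h \<in> carrier H \<Longrightarrow> comult H h \<in> carrier TT"
  using ring_hom_closed[OF comult_hom] by (simp add: tensor_square_simps)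

lemma comult_mult: "\<lbrakk>g \<in> carrier H; h \<in> carrier H\<rbrakk> \<Longrightarrow>
    comult H (g \<otimes> h) = act.act (comult H g) (comult H h)"
  using ring_hom_mult[OF comult_hom] by (simp add: tensor_square_simps)

lemma counit_hom: "counit H \<in> ring_hom H \<Z>"
  by (rule hopf_unfolded[THEN conjunct2, THEN conjunct2, THEN conjunct1])

lemma degree_subgroup: "additive_subgroup (D n) H"
  by (rule graded_unfolded[THEN conjunct2, THEN conjunct1, THEN spec])

lemma degree_closed: "x \<in> D n \<Longrightarrow> x \<in> carrier H"
  using additive_subgroup.a_Hcarr[OF degree_subgroup] .

lemma degree_mult: "\<lbrakk>x \<in> D m; y \<in> D n\<rbrakk> \<Longrightarrow> x \<otimes> y \<in> D (m + n)"
  using graded_unfolded[THEN conjunct2, THEN conjunct2, THEN conjunct2, THEN conjunct2, THEN conjunct1] by blast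

lemma degree_add: "\<lbrakk>x \<in> D n; y \<in> D n\<rbrakk> \<Longrightarrow> x \<oplus> y \<in> D n"
  using additive_subgroup.a_closed[OF degree_subgroup] .

lemma degree_a_inv: "x \<in> D n \<Longrightarrow> \<ominus> x \<in> D n"
  using subgroup.m_inv_closed[OF additive_subgroup.a_subgroup[OF degree_subgroup]]
  by (simp add: a_inv_def)

lemma degree_pow: "x \<in> D n \<Longrightarrow> [(k :: int)] \<cdot> x \<in> D n"
  using group.subgroup_int_pow_closed[OF a_group additive_subgroup.a_subgroup[OF degree_subgroup]]
  by (simp add: add_pow_def)

lemma degree_zero: "\<zero> \<in> D n"
  using additive_subgroup.zero_closed[OF degree_subgroup] .

lemma counit_degree: "\<lbrakk>n > 0; x \<in> D n\<rbrakk> \<Longrightarrow> counit H x = 0"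
  using graded_unfolded[THEN conjunct2, THEN conjunct2, THEN conjunct2, THEN conjunct2, THEN conjunct2, THEN conjunct2, THEN conjunct1] by blast

lemma degree_0: "x \<in> D 0 \<Longrightarrow> \<exists>k :: int. x = [k] \<cdot> \<one>"
  using conn unfolding connected_hopf_algebra_def bij_betw_def by blast

lemma comult_degree:
  assumes "x \<in> D n"
  shows "comult H x \<in> generate TT {pp y z | k l y z. k + l = n \<and> y \<in> D k \<and> z \<in> D l}"
proof (rule generate_mono_structure)
  show "comult H x \<in> generate (add_monoid (tensor_square H))
      {pp y z | k l y z. k + l = n \<and> y \<in> D k \<and> z \<in> D l}"
    using graded_unfolded[THEN conjunct2, THEN conjunct2, THEN conjunct2, THEN conjunct2, THEN conjunct2, THEN conjunct1] assms unfolding hopf_pure_def by blast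
qed (simp_all add: tensor_square_def tensor_algebra_def Let_def)

text \<open>The grading writes every element as a finite sum of homogeneous ones.\<close>

lemma additive_eqI:
  assumes h: "h \<in> hom (add_monoid H) K" "h' \<in> hom (add_monoid H) K" and K: "group K"
    and eq: "\<And>n x. x \<in> D n \<Longrightarrow> h x = h' x" and x: "x \<in> carrier H"
  shows "h x = h' x"
proof -
  interpret h: group_hom "add_monoid H" K h
    by (intro group_hom.intro group_hom_axioms.intro h K a_group)
  interpret h': group_hom "add_monoid H" K h'
    by (intro group_hom.intro group_hom_axioms.intro h K a_group)
  obtain c where c: "\<forall>n. c n \<in> D n" "finite {n. c n \<noteq> \<zero>}" "x = (\<Oplus>n\<in>{n. c n \<noteq> \<zero>}. c n)"
    using graded_unfolded[THEN conjunct2, THEN conjunct2, THEN conjunct1] x by blast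
  have "h (\<Oplus>n\<in>S. c n) = h' (\<Oplus>n\<in>S. c n)" if "finite S" for S
    using that
  proof (induction S)
    case empty
    then show ?case using h.hom_one h'.hom_one by simp
  next
    case (insert n S)
    have "c m \<in> carrier H" for m using c(1) degree_closed by blast
    moreover have "h (c n) = h' (c n)" by (rule eq[OF c(1)[THEN spec]])
    ultimately show ?case
      using insert h.hom_mult h'.hom_mult by (simp add: Pi_def)
  qed
  then show ?thesis using c(2,3) by simp
qed

text \<open>This is b \<otimes> id followed by the identification of Z \<otimes> H with H. For b the
  counit, the counit law says that it undoes \<open>comult\<close>.\<close>

definition contract :: "('h \<Rightarrow> int) \<Rightarrow> ('h, 'h) tensor \<Rightarrow> 'h" where
  "contract b = tensor_lift (add_monoid H) (\<lambda>x y. [b x] \<cdot> y)"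

lemma additive_functional:
  assumes b: "b \<in> hom (add_monoid H) integer_group"
  shows functional_add: "\<lbrakk>x \<in> carrier H; y \<in> carrier H\<rbrakk> \<Longrightarrow> b (x \<oplus> y) = b x + b y"
    and functional_pow: "x \<in> carrier H \<Longrightarrow> b ([(k :: int)] \<cdot> x) = k * b x"
  using hom_mult[OF b] hom_add_pow_int[OF b] by simp_all

lemma balanced_contract:
  assumes b: "b \<in> hom (add_monoid H) integer_group"
  shows "balanced_map \<Z> IA IA (add_monoid H) (\<lambda>x y. [b x] \<cdot> y)"
  by (intro balanced_map.intro balanced_map_axioms.intro act.S.tensor_factors_axioms a_comm_group)
    (simp_all add: add_pow_int_closed add_pow_int_add add_pow_int_distrib functional_add[OF b]
      functional_pow[OF b] add_pow_int_mult[symmetric] mult.commute)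

lemma contract_hom: "b \<in> hom (add_monoid H) integer_group \<Longrightarrow> contract b \<in> hom TT (add_monoid H)"
  unfolding contract_def by (rule balanced_map.tensor_lift_hom[OF balanced_contract])

lemma contract_closed:
  "\<lbrakk>b \<in> hom (add_monoid H) integer_group; t \<in> carrier TT\<rbrakk> \<Longrightarrow> contract b t \<in> carrier H"
  using hom_in_carrier[OF contract_hom, of b t] by simp

lemma contract_pure: "\<lbrakk>b \<in> hom (add_monoid H) integer_group; x \<in> carrier H; y \<in> carrier H\<rbrakk> \<Longrightarrow>
    contract b (pp x y) = [b x] \<cdot> y"
  unfolding contract_def by (subst balanced_map.tensor_lift_pure[OF balanced_contract]) simp_all

lemma counit_functional: "counit H \<in> hom (add_monoid H) integer_group"
  using ring_hom_add[OF counit_hom] by (auto intro!: homI)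

lemma counit_one: "counit H \<one> = 1"
  using ring_hom_one[OF counit_hom] by simp

lemma contract_counit_comult: "h \<in> carrier H \<Longrightarrow> contract (counit H) (comult H h) = h"
  using hopf_unfolded[THEN conjunct2, THEN conjunct2, THEN conjunct2, THEN conjunct2, THEN conjunct1] unfolding contract_def by blast

section \<open>The coproduct of an element of degree 1\<close>

lemma pure_tensor_hom_left: "y \<in> carrier H \<Longrightarrow> (\<lambda>x. pp x y) \<in> hom (add_monoid H) TT"
  using act.S.pure_tensor_add_left[simplified] act.S.pure_tensor_closed[simplified] by (intro homI) auto

lemma pure_tensor_hom_right: "x \<in> carrier H \<Longrightarrow> pp x \<in> hom (add_monoid H) TT"
  using act.S.pure_tensor_add_right[simplified] act.S.pure_tensor_closed[simplified] by (intro homI) auto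

text \<open>In fact \<open>a = g\<close>, that is, \<open>g\<close> is primitive, but this is not needed.\<close>

lemma comult_degree_1:
  assumes g: "g \<in> D 1"
  obtains a where "a \<in> D 1" "comult H g = pp a \<one> \<otimes>\<^bsub>TT\<^esub> pp \<one> g"
proof -
  interpret TTG: comm_group TT by (rule act.S.tensor_comm_group)
  interpret l: group_hom "add_monoid H" TT "\<lambda>x. pp x \<one>"
    by (intro group_hom.intro group_hom_axioms.intro pure_tensor_hom_left a_group TTG.is_group) simp
  interpret r: group_hom "add_monoid H" TT "pp \<one>"
    by (intro group_hom.intro group_hom_axioms.intro pure_tensor_hom_right a_group TTG.is_group) simp
  \<comment> \<open>These are the elements of D_1 \<otimes> D_0 + D_0 \<otimes> D_1, because
    connectedness makes D_0 the multiples of the unit. S is a subgroup containing the generators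
    provided by the grading, hence contains the coproduct of g.\<close>
  define S where "S = {pp a \<one> \<otimes>\<^bsub>TT\<^esub> pp \<one> c | a c. a \<in> D 1 \<and> c \<in> D 1}"
  have SI: "pp a \<one> \<otimes>\<^bsub>TT\<^esub> pp \<one> c \<in> S" if "a \<in> D 1" "c \<in> D 1" for a c
    unfolding S_def using that by blast
  have pp_closed: "pp a \<one> \<in> carrier TT" "pp \<one> a \<in> carrier TT" if "a \<in> D 1" for a
    using l.hom_closed r.hom_closed degree_closed[OF that] by simp_all
  have "subgroup S TT"
  proof (rule TTG.subgroupI)
    show "S \<subseteq> carrier TT"
      unfolding S_def using pp_closed TTG.m_closed by blast
    show "S \<noteq> {}" using SI[OF degree_zero degree_zero] by blast
    show "inv\<^bsub>TT\<^esub> s \<in> S" if s: "s \<in> S" for s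
    proof -
      obtain a c where ac: "a \<in> D 1" "c \<in> D 1" "s = pp a \<one> \<otimes>\<^bsub>TT\<^esub> pp \<one> c"
        using s unfolding S_def by blast
      have "inv\<^bsub>TT\<^esub> s = pp (\<ominus> a) \<one> \<otimes>\<^bsub>TT\<^esub> pp \<one> (\<ominus> c)"
        using l.hom_inv[of a] r.hom_inv[of c] ac degree_closed[OF ac(1)] degree_closed[OF ac(2)]
        by (simp add: TTG.inv_mult pp_closed a_inv_def)
      then show ?thesis using SI[OF degree_a_inv[OF ac(1)] degree_a_inv[OF ac(2)]] by simp
    qed
    show "s \<otimes>\<^bsub>TT\<^esub> t \<in> S" if s: "s \<in> S" and t: "t \<in> S" for s t
    proof -
      obtain a c where ac: "a \<in> D 1" "c \<in> D 1" "s = pp a \<one> \<otimes>\<^bsub>TT\<^esub> pp \<one> c"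
        using s unfolding S_def by blast
      obtain a' c' where ac': "a' \<in> D 1" "c' \<in> D 1" "t = pp a' \<one> \<otimes>\<^bsub>TT\<^esub> pp \<one> c'"
        using t unfolding S_def by blast
      have "s \<otimes>\<^bsub>TT\<^esub> t = pp (a \<oplus> a') \<one> \<otimes>\<^bsub>TT\<^esub> pp \<one> (c \<oplus> c')"
        using l.hom_mult[of a a'] r.hom_mult[of c c'] degree_closed ac ac'
        by (simp add: TTG.m_ac pp_closed)
      then show ?thesis using SI[OF degree_add[OF ac(1) ac'(1)] degree_add[OF ac(2) ac'(2)]] by simp
    qed
  qed
  moreover have "{pp y z | k l y z. k + l = 1 \<and> y \<in> D k \<and> z \<in> D l} \<subseteq> S"
  proof clarify
    fix k l :: nat and y z
    assume kl: "k + l = 1" and y: "y \<in> D k" and z: "z \<in> D l"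
    consider "k = 0" "l = 1" | "k = 1" "l = 0" using kl by linarith
    then show "pp y z \<in> S"
    proof cases
      case 1
      obtain m :: int where m: "y = [m] \<cdot> \<one>" using degree_0 y 1 by blast
      have mz: "[m] \<cdot> z \<in> D 1"
        using z 1 by (simp add: degree_pow)
      \<comment> \<open>The integer m crosses the tensor sign; the missing summand is supplied by
        the zero of degree 1.\<close>
      have "pp y z = pp \<one> ([m] \<cdot> z)"
        using act.S.pure_tensor_balanced[of m \<one> z] degree_closed[OF z] m by simp
      also have "\<dots> = pp \<zero> \<one> \<otimes>\<^bsub>TT\<^esub> pp \<one> ([m] \<cdot> z)"
        using l.hom_one pp_closed[OF mz] by simp
      finally show ?thesis using SI[OF degree_zero mz] by simp
    next
      case 2
      obtain m :: int where m: "z = [m] \<cdot> \<one>" using degree_0 z 2 by blast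
      have my: "[m] \<cdot> y \<in> D 1" using y 2 by (simp add: degree_pow)
      have "pp y z = pp ([m] \<cdot> y) \<one>"
        using act.S.pure_tensor_balanced[of m y \<one>] degree_closed[OF y] m by simp
      also have "\<dots> = pp ([m] \<cdot> y) \<one> \<otimes>\<^bsub>TT\<^esub> pp \<one> \<zero>"
        using r.hom_one pp_closed[OF my] by simp
      finally show ?thesis using SI[OF my degree_zero] by simp
    qed
  qed
  moreover have "comult H g \<in> generate TT {pp y z | k l y z. k + l = 1 \<and> y \<in> D k \<and> z \<in> D l}"
    using comult_degree[OF g] .
  ultimately have "comult H g \<in> S"
    using TTG.generate_subgroup_incl by blast
  then obtain a c where ac: "a \<in> D 1" "c \<in> D 1" "comult H g = pp a \<one> \<otimes>\<^bsub>TT\<^esub> pp \<one> c"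
    unfolding S_def by blast
  \<comment> \<open>Applying the counit to the left legs returns g by the counit law. It kills a,
    which has positive degree, and sends the unit to 1, so what remains is c.\<close>
  have "g = contract (counit H) (pp a \<one> \<otimes>\<^bsub>TT\<^esub> pp \<one> c)"
    using contract_counit_comult[OF degree_closed[OF g]] ac(3) by simp
  also have "\<dots> = [counit H a] \<cdot> \<one> \<oplus> [counit H \<one>] \<cdot> c"
    using hom_mult[OF contract_hom[OF counit_functional] pp_closed(1)[OF ac(1)] pp_closed(2)[OF ac(2)]]
      degree_closed[OF ac(1)] degree_closed[OF ac(2)]
    by (simp add: contract_pure counit_functional)
  also have "\<dots> = c"
    using degree_closed[OF ac(2)] counit_degree[OF _ ac(1)]
    by (simp add: counit_one add_pow_int_0 add_pow_int_1)
  finally show thesis using that ac by simp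
qed

section \<open>Contraction of the coproduct as a derivation\<close>

text \<open>\<open>contract b \<circ> \<Delta>\<close> is the adjoint of multiplication by \<open>b\<close>; it is a derivation with respect to
  products with \<open>g\<close>.\<close>

lemma contract_comult_mult:
  assumes b: "b \<in> hom (add_monoid H) integer_group" and b1: "\<And>n x. \<lbrakk>n \<noteq> 1; x \<in> D n\<rbrakk> \<Longrightarrow> b x = 0"
    and g: "g \<in> D 1" and a: "a \<in> D 1" "comult H g = pp a \<one> \<otimes>\<^bsub>TT\<^esub> pp \<one> g"
    and h: "h \<in> carrier H"
  shows "contract b (comult H (g \<otimes> h)) = [b a] \<cdot> h \<oplus> g \<otimes> contract b (comult H h)"
proof -
  note gH = degree_closed[OF g] and aH = degree_closed[OF a(1)]
  have pp: "pp a \<one> \<in> carrier TT" "pp \<one> g \<in> carrier TT"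
    using act.S.pure_tensor_closed[simplified] gH aH by simp_all
  \<comment> \<open>For x of degree n the product has degree n + 1, where b vanishes unless n = 0;
    in degree 0 connectedness makes x a multiple of the unit. The counit singles out the same
    degree.\<close>
  have b_mult: "b (a \<otimes> x) = b a * counit H x" if x: "x \<in> carrier H" for x
  proof (rule additive_eqI[where h = "\<lambda>x. b (a \<otimes> x)" and h' = "\<lambda>x. b a * counit H x"])
    show "(\<lambda>x. b (a \<otimes> x)) \<in> hom (add_monoid H) integer_group"
      using aH by (intro homI) (simp_all add: r_distr functional_add[OF b])
    show "(\<lambda>x. b a * counit H x) \<in> hom (add_monoid H) integer_group"
      by (intro homI) (simp_all add: functional_add[OF counit_functional] algebra_simps)
    show "b (a \<otimes> x) = b a * counit H x" if x: "x \<in> D n" for n x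
    proof (cases "n = 0")
      case True
      then obtain k :: int where "x = [k] \<cdot> \<one>" using degree_0 x by blast
      then show ?thesis
        using aH by (simp add: add_pow_rdistr_int functional_pow[OF b]
            functional_pow[OF counit_functional] counit_one)
    next
      case False
      then show ?thesis using b1[OF _ degree_mult[OF a(1) x]] counit_degree[OF _ x] by simp
    qed
  qed (use x in simp_all)
  \<comment> \<open>Multiplication by \<open>pp a \<one>\<close> changes left legs only; there
    \<open>b_mult\<close> trades b for the counit, which the counit law will remove.\<close>
  have left: "contract b (act.act (pp a \<one>) t) = [b a] \<cdot> contract (counit H) t" if t: "t \<in> carrier TT" for t
  proof (rule act.S.tensor_hom_eqI[where h = "\<lambda>t. contract b (act.act (pp a \<one>) t)"
        and h' = "\<lambda>t. [b a] \<cdot> contract (counit H) t", OF a_group _ _ _ t])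
    show "(\<lambda>t. contract b (act.act (pp a \<one>) t)) \<in> hom TT (add_monoid H)"
      using hom_compose[OF act.act_hom_right[OF pp(1)] contract_hom[OF b]] by (simp add: comp_def)
    show "(\<lambda>t. [b a] \<cdot> contract (counit H) t) \<in> hom TT (add_monoid H)"
      by (intro homI) (simp_all add: contract_closed counit_functional add_pow_int_closed
          add_pow_int_distrib hom_mult[OF contract_hom])
    show "contract b (act.act (pp a \<one>) (pp x y)) = [b a] \<cdot> contract (counit H) (pp x y)"
      if "x \<in> carrier IA" "y \<in> carrier IA" for x y
      using that aH act.act_pure[of a \<one> x y]
      by (simp add: contract_pure b counit_functional b_mult add_pow_int_mult)
  qed
  \<comment> \<open>Multiplication by \<open>pp \<one> g\<close> changes right legs only, where b
    merely contributes integer factors, so g can be pulled out.\<close>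
  have right: "contract b (act.act (pp \<one> g) t) = g \<otimes> contract b t" if t: "t \<in> carrier TT" for t
  proof (rule act.S.tensor_hom_eqI[where h = "\<lambda>t. contract b (act.act (pp \<one> g) t)"
        and h' = "\<lambda>t. g \<otimes> contract b t", OF a_group _ _ _ t])
    show "(\<lambda>t. contract b (act.act (pp \<one> g) t)) \<in> hom TT (add_monoid H)"
      using hom_compose[OF act.act_hom_right[OF pp(2)] contract_hom[OF b]] by (simp add: comp_def)
    show "(\<lambda>t. g \<otimes> contract b t) \<in> hom TT (add_monoid H)"
      using gH by (intro homI) (simp_all add: contract_closed b r_distr hom_mult[OF contract_hom])
    show "contract b (act.act (pp \<one> g) (pp x y)) = g \<otimes> contract b (pp x y)"
      if "x \<in> carrier IA" "y \<in> carrier IA" for x y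
      using that gH act.act_pure[of \<one> g x y]
      by (simp add: contract_pure b add_pow_rdistr_int)
  qed
  note t = comult_closed[OF h]
  have "contract b (comult H (g \<otimes> h)) =
      contract b (act.act (pp a \<one>) (comult H h) \<otimes>\<^bsub>TT\<^esub> act.act (pp \<one> g) (comult H h))"
    unfolding comult_mult[OF gH h] a(2) using hom_mult[OF act.act_hom_left[OF t] pp] by simp
  also have "\<dots> = contract b (act.act (pp a \<one>) (comult H h)) \<oplus> contract b (act.act (pp \<one> g) (comult H h))"
    using hom_mult[OF contract_hom[OF b] act.act_closed[OF pp(1) t] act.act_closed[OF pp(2) t]] by simp
  also have "\<dots> = [b a] \<cdot> h \<oplus> g \<otimes> contract b (comult H h)"
    by (simp add: left[OF t] right[OF t] contract_counit_comult[OF h])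
  finally show ?thesis .
qed

text \<open>In degree 0 the coproduct lies in D_0 \<otimes> D_0, and b kills every left leg. This
  starts the induction of \<open>contract_comult_powers\<close>.\<close>

lemma contract_comult_degree_0:
  assumes b: "b \<in> hom (add_monoid H) integer_group" and b0: "\<And>x. x \<in> D 0 \<Longrightarrow> b x = 0"
    and h: "h \<in> D 0"
  shows "contract b (comult H h) = \<zero>"
proof -
  interpret TTG: comm_group TT by (rule act.S.tensor_comm_group)
  interpret c: group_hom TT "add_monoid H" "contract b"
    by (intro group_hom.intro group_hom_axioms.intro contract_hom b a_group TTG.is_group)
  have "{pp y z | k l y z. k + l = 0 \<and> y \<in> D k \<and> z \<in> D l} \<subseteq> kernel TT (add_monoid H) (contract b)"
    using act.S.pure_tensor_closed[simplified]
    by (auto simp: kernel_def contract_pure b b0 degree_closed add_pow_int_0)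
  then have "generate TT {pp y z | k l y z. k + l = 0 \<and> y \<in> D k \<and> z \<in> D l}
      \<subseteq> kernel TT (add_monoid H) (contract b)"
    by (rule TTG.generate_subgroup_incl) (rule c.subgroup_kernel)
  moreover have "comult H h \<in> generate TT {pp y z | k l y z. k + l = 0 \<and> y \<in> D k \<and> z \<in> D l}"
    using comult_degree[OF h] .
  ultimately show ?thesis by (auto simp: kernel_def)
qed

text \<open>The Leibniz rule: G n is G 0 multiplied n times on the left by g. Each factor
  contributes b a once and G 0 at the bottom contributes nothing, so G (Suc n) yields n + 1 equal
  terms.\<close>

lemma contract_comult_powers:
  assumes b: "b \<in> hom (add_monoid H) integer_group" and b1: "\<And>n x. \<lbrakk>n \<noteq> 1; x \<in> D n\<rbrakk> \<Longrightarrow> b x = 0"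
    and g: "g \<in> D 1" and a: "a \<in> D 1" "comult H g = pp a \<one> \<otimes>\<^bsub>TT\<^esub> pp \<one> g"
    and G: "G 0 \<in> D 0" "\<And>n. G (Suc n) = g \<otimes> G n"
  shows "contract b (comult H (G (Suc n))) = [(int (Suc n) * b a)] \<cdot> G n"
proof -
  have GH: "G n \<in> carrier H" for n
    by (induction n) (simp_all add: G degree_closed[OF G(1)] degree_closed[OF g])
  have step: "contract b (comult H (G (Suc n))) = [b a] \<cdot> G n \<oplus> g \<otimes> contract b (comult H (G n))" for n
    unfolding G(2) by (rule contract_comult_mult[OF b b1 g a GH])
  show ?thesis
  proof (induction n)
    case 0
    have "contract b (comult H (G 0)) = \<zero>"
      using contract_comult_degree_0[OF b b1[OF zero_neq_one] G(1)] .
    then show ?case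
      using step[of 0] degree_closed[OF g] by (simp add: add_pow_int_closed GH)
  next
    case (Suc n)
    have "[b a] \<cdot> G (Suc n) \<oplus> g \<otimes> ([(int (Suc n) * b a)] \<cdot> G n) =
        [b a] \<cdot> G (Suc n) \<oplus> [(int (Suc n) * b a)] \<cdot> G (Suc n)"
      using degree_closed[OF g] by (simp only: add_pow_rdistr_int GH G(2))
    also have "\<dots> = [(int (Suc (Suc n)) * b a)] \<cdot> G (Suc n)"
      by (subst add_pow_int_add[OF GH, symmetric]) (simp add: algebra_simps)
    finally show ?case unfolding step[of "Suc n"] Suc.IH .
  qed
qed

text \<open>The functional b \<otimes> b' factors as b on the left legs followed by b' on the
  result. This brings the right-hand side of the adjointness in \<open>graded_dual\<close> into
  terms of \<open>contract\<close>.\<close>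

lemma functional_contract:
  assumes b: "b \<in> hom (add_monoid H) integer_group" and b': "b' \<in> hom (add_monoid H) integer_group"
    and t: "t \<in> carrier TT"
  shows "tensor_lift integer_group (\<lambda>x y. b x * b' y) t = b' (contract b t)"
proof -
  interpret m: balanced_map \<Z> IA IA integer_group "\<lambda>x y. b x * b' y"
    by (intro balanced_map.intro balanced_map_axioms.intro act.S.tensor_factors_axioms abelian_integer_group)
      (simp_all add: functional_add[OF b] functional_add[OF b'] functional_pow[OF b] functional_pow[OF b']
        algebra_simps)
  show ?thesis
  proof (rule act.S.tensor_hom_eqI[where h = "tensor_lift integer_group (\<lambda>x y. b x * b' y)"
        and h' = "\<lambda>t. b' (contract b t)", OF group_integer_group m.tensor_lift_hom _ _ t])
    show "(\<lambda>t. b' (contract b t)) \<in> hom TT integer_group"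
      using hom_compose[OF contract_hom[OF b] b'] by (simp add: comp_def)
    show "tensor_lift integer_group (\<lambda>x y. b x * b' y) (pp x y) = b' (contract b (pp x y))"
      if "x \<in> carrier IA" "y \<in> carrier IA" for x y
      using that m.tensor_lift_pure[of x y] by (simp add: contract_pure b functional_pow[OF b'])
  qed
qed

end

section \<open>The dimensions of a tower\<close>

lemma in_degree_part:
  "x \<in> carrier (grothendieck \<kappa> (A n)) \<Longrightarrow> in_degree \<kappa> A n x \<in> degree_part \<kappa> A n"
  unfolding degree_part_def by (rule imageI)

text \<open>The induced module prescribed by \<open>induction_product\<close> is isomorphic to a
  regular module, and \<open>mclass\<close> depends only on the isomorphism type. With \<kappa>
  arbitrary the result serves K(A) and G(A) alike.\<close>

lemma induction_product_regular:
  assumes tower: "tower_of_algebras A \<rho>" and prod: "induction_product \<kappa> A \<rho> H"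
  shows "in_degree \<kappa> A m (mclass \<kappa> (A m) (fin_dim_algebra.regular_copy (A m))) \<otimes>\<^bsub>H\<^esub>
      in_degree \<kappa> A n (mclass \<kappa> (A n) (fin_dim_algebra.regular_copy (A n))) =
      in_degree \<kappa> A (m + n) (mclass \<kappa> (A (m + n)) (fin_dim_algebra.regular_copy (A (m + n))))"
proof -
  have alg: "fd_algebra (A n)" for n
    using tower unfolding tower_of_algebras_def by simp
  interpret mn: two_algebras "A m" "A n"
    by (intro two_algebras.intro fin_dim_algebra.intro alg)
  interpret A: fin_dim_algebra "A (m + n)" by (intro fin_dim_algebra.intro alg)
  have \<rho>: "\<rho> m n \<in> ring_hom (algebra_tensor (A m) (A n)) (A (m + n))"
    using tower unfolding tower_of_algebras_def algebra_homs_def by simp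
  \<comment> \<open>The isomorphism starts at the regular module, since \<open>mclass_cong\<close>
    wants closure under the operations for its first module.\<close>
  have "mclass \<kappa> (A (m + n)) (left_regular (A (m + n))) = mclass \<kappa> (A (m + n))
      (induced_module (algebra_tensor (A m) (A n)) (A (m + n)) (\<rho> m n) mn.ET)"
    by (rule mclass_cong[OF mn.induced_external_tensor_regular[OF A.alg_ring \<rho>]]) simp_all
  then show ?thesis
    using prod mn.B.regular_copy_modules_in[of \<kappa>] mn.C.regular_copy_modules_in[of \<kappa>]
    unfolding induction_product_def A.mclass_regular_copy by simp
qed

text \<open>The unit spans: x and the multiple of the unit by f x have the same image under the
  isomorphism f to the complex numbers. This value starts the recursion for the dimensions.\<close>

lemma dim_degree_0:
  assumes "tower_of_algebras A \<rho>"
  shows "vectorspace.dim class_ring (A 0) = 1"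
proof -
  have "fd_algebra (A 0)"
    using assms unfolding tower_of_algebras_def by simp
  then interpret A: fin_dim_algebra "A 0" by (rule fin_dim_algebra.intro)
  obtain f where f: "f \<in> algebra_homs (A 0) complex_algebra" "bij_betw f (carrier (A 0)) UNIV"
    using assms unfolding tower_of_algebras_def by blast
  then have hom: "f \<in> ring_hom (A 0) complex_algebra"
    "\<And>z x. x \<in> carrier (A 0) \<Longrightarrow> f (z \<odot>\<^bsub>A 0\<^esub> x) = z * f x"
    by (auto simp: algebra_homs_def complex_algebra_def)
  have add: "f (x \<oplus>\<^bsub>A 0\<^esub> y) = f x + f y" if "x \<in> carrier (A 0)" "y \<in> carrier (A 0)" for x y
    using ring_hom_add[OF hom(1) that] by (simp add: complex_algebra_def)
  have zero: "f \<zero>\<^bsub>A 0\<^esub> = 0"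
    using add[OF A.B.zero_closed A.B.zero_closed] by simp
  have one: "f \<one>\<^bsub>A 0\<^esub> = 1"
    using ring_hom_one[OF hom(1)] by (simp add: complex_algebra_def)
  interpret V: vectorspace "class_ring :: complex ring" "A 0" by (rule A.alg_vectorspace)
  show ?thesis
  proof (rule V.dim1I)
    show "\<one>\<^bsub>A 0\<^esub> \<in> carrier (A 0)" by simp
    show "\<one>\<^bsub>A 0\<^esub> \<noteq> \<zero>\<^bsub>A 0\<^esub>" using zero one by auto
    have "x = f x \<odot>\<^bsub>A 0\<^esub> \<one>\<^bsub>A 0\<^esub>" if x: "x \<in> carrier (A 0)" for x
    proof (rule inj_onD[OF bij_betw_imp_inj_on[OF f(2)] _ x])
      show "f x = f (f x \<odot>\<^bsub>A 0\<^esub> \<one>\<^bsub>A 0\<^esub>)" by (simp add: hom one)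
    qed simp
    then have "x \<in> V.span {\<one>\<^bsub>A 0\<^esub>}" if "x \<in> carrier (A 0)" for x
      using that V.span_mem[of "{\<one>\<^bsub>A 0\<^esub>}" "\<one>\<^bsub>A 0\<^esub>"] V.span_is_submodule[of "{\<one>\<^bsub>A 0\<^esub>}"]
      submodule.smult_closed[of class_ring "V.span {\<one>\<^bsub>A 0\<^esub>}" "A 0" "f x" "\<one>\<^bsub>A 0\<^esub>"] by simp
    moreover have "V.span {\<one>\<^bsub>A 0\<^esub>} \<subseteq> carrier (A 0)"
      by (rule V.span_is_subset2) simp
    ultimately show "V.gen_set {\<one>\<^bsub>A 0\<^esub>}" by blast
  qed
qed

theorem theorem1p1:
  fixes A :: "nat \<Rightarrow> (complex, 'a) module"
    and \<rho> :: "nat \<Rightarrow> nat \<Rightarrow> ('a, 'a) tensor \<Rightarrow> 'a"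
    and r :: nat
  assumes "tower_of_algebras A \<rho>"
    and "form_graded_dual_hopf_algebras A \<rho>"
    and "r = vectorspace.dim class_ring (A 1)"
  shows "\<forall>n. vectorspace.dim class_ring (A n) = r ^ n * fact n"
proof -
  note tower = assms(1)
  obtain K G \<beta> where K: "grothendieck_hopf Projective A \<rho> K" and G: "grothendieck_hopf All A \<rho> G"
    and \<beta>: "hom_pairing A \<beta>" and dual: "graded_dual K (degree_part Projective A) G (degree_part All A) \<beta>"
    using assms(2) unfolding form_graded_dual_hopf_algebras_def by (elim exE conjE)
  have alg: "fin_dim_algebra (A n)" for n
    using tower unfolding tower_of_algebras_def by (simp add: fin_dim_algebra.intro)
  define R where "R n = fin_dim_algebra.regular_copy (A n)" for n
  have R_in: "R n \<in> modules_in \<kappa> (A n)" for \<kappa> n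
    unfolding R_def using fin_dim_algebra.regular_copy_modules_in[OF alg] .
  \<comment> \<open>\<open>c Projective n\<close> and \<open>c All n\<close> are the classes P_n and
    G_n of the overview, both taken from the one module \<open>R n\<close>.\<close>
  define c where "c \<kappa> n = in_degree \<kappa> A n (mclass \<kappa> (A n) (R n))" for \<kappa> n
  define d where "d n = vectorspace.dim class_ring (A n)" for n

  interpret K: graded_connected_hopf K "degree_part Projective A"
    using K unfolding grothendieck_hopf_def by (intro graded_connected_hopf.intro) simp_all
  interpret G: graded_connected_hopf G "degree_part All A"
    using G unfolding grothendieck_hopf_def by (intro graded_connected_hopf.intro) simp_all

  have c_degree: "c \<kappa> n \<in> degree_part \<kappa> A n" for \<kappa> n
    unfolding c_def R_def fin_dim_algebra.mclass_regular_copy[OF alg]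
    by (intro in_degree_part mclass_closed[OF fin_dim_algebra.regular_copy_isomorphic[OF alg]]
        fin_dim_algebra.regular_copy_modules_in[OF alg])
  have c_mult: "c Projective m \<otimes>\<^bsub>K\<^esub> c Projective n = c Projective (m + n)"
    "c All m \<otimes>\<^bsub>G\<^esub> c All n = c All (m + n)" for m n
    using K G induction_product_regular[OF tower]
    unfolding c_def R_def grothendieck_hopf_def by blast+
  have carrier_K: "c Projective n \<in> carrier K" and carrier_G: "c All n \<in> carrier G" for n
    using K.degree_closed[OF c_degree] G.degree_closed[OF c_degree] .
  \<comment> \<open>The record \<open>G\<close> differs from \<open>grothendieck_sum All A\<close>,
    but carrier and addition coincide, and \<open>hom\<close> looks at nothing else.\<close>
  have \<beta>_hom: "\<beta> x \<in> hom (add_monoid G) integer_group" if "x \<in> carrier K" for x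
    using \<beta> that K G unfolding hom_pairing_def grothendieck_hopf_def by (simp add: hom_def)
  have \<beta>_dim: "\<beta> (c Projective n) (c All n) = int (d n)" for n
    using \<beta> R_in fin_dim_algebra.dim_hom_space_regular_copy[OF alg]
    unfolding hom_pairing_def c_def d_def R_def by simp
  have \<beta>_degree: "\<beta> (c Projective 1) x = 0" if "n \<noteq> 1" "x \<in> degree_part All A n" for n x
    using dual[unfolded graded_dual_def, THEN conjunct1, rule_format, OF that(1)[symmetric] c_degree that(2)] .
  have \<beta>_mult: "\<beta> (x \<otimes>\<^bsub>K\<^esub> y) h = \<beta> y (G.contract (\<beta> x) (comult G h))"
    if "x \<in> carrier K" "y \<in> carrier K" "h \<in> carrier G" for x y h
    unfolding G.functional_contract[OF \<beta>_hom \<beta>_hom G.comult_closed, OF that, symmetric]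
    using dual[unfolded graded_dual_def, THEN conjunct2, THEN conjunct2, THEN conjunct2, THEN conjunct1] that
    by blast

  obtain a where a: "a \<in> degree_part All A 1"
    "comult G (c All 1) = G.pp a \<one>\<^bsub>G\<^esub> \<otimes>\<^bsub>G.TT\<^esub> G.pp \<one>\<^bsub>G\<^esub> (c All 1)"
    by (rule G.comult_degree_1[OF c_degree])
  \<comment> \<open>At this point b is just the pairing of P_1 with the left leg a of the coproduct
    of G_1; the recursion itself determines its value below.\<close>
  define b where "b = \<beta> (c Projective 1) a"
  have step: "int (d (Suc n)) = int (Suc n) * b * int (d n)" for n
  proof -
    have "int (d (Suc n)) = \<beta> (c Projective 1 \<otimes>\<^bsub>K\<^esub> c Projective n) (c All (Suc n))"
      by (simp add: c_mult \<beta>_dim)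
    also have "\<dots> = \<beta> (c Projective n) (G.contract (\<beta> (c Projective 1)) (comult G (c All (Suc n))))"
      by (rule \<beta>_mult[OF carrier_K carrier_K carrier_G])
    also have "\<dots> = \<beta> (c Projective n) ([(int (Suc n) * b)] \<cdot>\<^bsub>G\<^esub> c All n)"
      unfolding b_def
      using G.contract_comult_powers[where G = "c All", OF \<beta>_hom[OF carrier_K] \<beta>_degree c_degree a c_degree]
      by (simp add: c_mult)
    also have "\<dots> = int (Suc n) * b * int (d n)"
      by (simp add: G.functional_pow[OF \<beta>_hom[OF carrier_K] carrier_G] \<beta>_dim)
    finally show ?thesis .
  qed
  have d0: "d 0 = 1" unfolding d_def by (rule dim_degree_0[OF tower])
  \<comment> \<open>At n = 0 the recursion reads d 1 = b * d 0 with d 0 = 1.\<close>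
  have b: "b = int r" using step[of 0] d0 assms(3) by (simp add: d_def)
  have "int (d n) = int (r ^ n * fact n)" for n
    proof (induction n)
    case (Suc n)
    show ?case unfolding step b Suc.IH by (simp add: algebra_simps)
  qed (simp add: d0)
  then show ?thesis unfolding d_def of_nat_eq_iff ..
qed

end
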